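(* Consider the model D-EX-N$(\zeta_n)$ described in the context with $\lim_{n\to\infty}\zeta_n=1$. The set of largest crossing points is $C_1=\{0\}\cup(t_2,\alpha)$, and \[ \operatorname{EER}_\infty(1)=\frac{t_2\,\Phi(x_0(t_2\mid1))}{\alpha}+\int_{t_2/\alpha}^{1}\Phi(x_0(\alpha t\mid 1))\,dt,\qquad \operatorname{FDR}_\infty(1)=\Phi(x_0(t_2\mid 1)). \]
   Context: Model D-EX-N$(\zeta_n)$: fix $\alpha\in(0,1)$ and $\rho\in(0,1)$, $\overline\rho=1-\rho$; $\Phi$ is the standard normal c.d.f. Let $X_0,X_1,\dots,X_n$ be i.i.d. $N(0,1)$. For $H_i:\vartheta_i=0$ vs $K_i:\vartheta_i>0$, $T_i=\vartheta_i+\sqrt{\overline\rho}X_i-\sqrt\rho X_0$ with $p$-values $p_i=1-\Phi(T_i)$; $\vartheta_i=\infty$ is allowed and gives $p_i=0$ a.s. For each $n$, exactly $n_0$ hypotheses are true ($\vartheta_i=0$), $\zeta_n=n_0/n$, the others have $\vartheta_i=\infty$. The LSU procedure at level $\alpha$ rejects all $H_i$ with $p_i\le m\alpha/n$, $m=\max\{i:p_{i:n}\le i\alpha/n\}$. $V_n$ = number of rejected true hypotheses, $R_n$ = number of rejections, $\operatorname{EER}_\infty(1)=\lim_n\mathbb E[V_n/n]$, $\operatorname{FDR}_\infty(1)=\lim_n\mathbb E[V_n/(R_n\vee1)]$. Given $X_0=x_0$, $F_\infty(t\mid x_0)=1-\Phi\big(\Phi^{-1}(1-t)/\sqrt{\overline\rho}+\sqrt{\rho/\overline\rho}\,x_0\big)$,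 $t\in(0,1)$, $F_\infty(0\mid x_0)=0$. For $t\in(0,\alpha)$, $F_\infty(t\mid x_0)=t/\alpha$ iff $x_0=x_0(t\mid1):=\sqrt{\overline\rho/\rho}\,\Phi^{-1}(1-t/\alpha)-\Phi^{-1}(1-t)/\sqrt\rho$. Let $t(x_0\mid1)=\sup\{t\in[0,\alpha]:F_\infty(t\mid x_0)=t/\alpha\}$, called a largest crossing point (LCP) when $F_\infty(\cdot\mid x_0)$ lies above $t/\alpha$ just to the left and below just to the right of it; $C_1$ is the set of LCPs. With $d(u\mid x_0,1)=1-\Phi(u/\sqrt{\overline\rho}+\sqrt{\rho/\overline\rho}\,x_0)-(1-\Phi(u))/\alpha$ and $u_2(x_0)=-x_0/\sqrt\rho-\sqrt{\overline\rho/\rho}\sqrt{x_0^2-2\ln(\sqrt{\overline\rho}/\alpha)}$, there is a unique tangent point: a value $x_0^*$ with $u_2(x_0^* )$ real and $d(u_2(x_0^* )\mid x_0^*,1)=0$ (where $F_\infty(\cdot\mid x_0^* )$ touches the line $t\mapsto t/\alpha$); $t_2=1-\Phi(u_2(x_0^* ))$, so that $x_0(t_2\mid1)=x_0^*$. *)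

theory Defs
  imports "HOL-Probability.Probability"
begin

definition Phi :: "real \<Rightarrow> real" where
  "Phi x = (LBINT t:{..x}. std_normal_density t)"

definition Phi_inv :: "real \<Rightarrow> real" where
  "Phi_inv p = (THE x. Phi x = p)"

text \<open>Conditional limiting ecdf F_infty(t | x0); F(t)=0 for t \<le> 0 and F(t)=1 for t \<ge> 1.\<close>
definition F_inf :: "real \<Rightarrow> real \<Rightarrow> real \<Rightarrow> real" where
  "F_inf \<rho> x0 t =
     (if t \<le> 0 then 0 else if t \<ge> 1 then 1
      else 1 - Phi (Phi_inv (1 - t) / sqrt (1 - \<rho>) + sqrt (\<rho> / (1 - \<rho>)) * x0))"

definition x0_of :: "real \<Rightarrow> real \<Rightarrow> real \<Rightarrow> real" where
  "x0_of \<rho> \<alpha> t = sqrt ((1 - \<rho>) / \<rho>) * Phi_inv (1 - t / \<alpha>) - Phi_inv (1 - t) / sqrt \<rho>"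

definition tcross :: "real \<Rightarrow> real \<Rightarrow> real \<Rightarrow> real" where
  "tcross \<rho> \<alpha> x0 = Sup {t \<in> {0..\<alpha>}. F_inf \<rho> x0 t = t / \<alpha>}"

definition is_LCP :: "real \<Rightarrow> real \<Rightarrow> real \<Rightarrow> real \<Rightarrow> bool" where
  "is_LCP \<rho> \<alpha> x0 t \<longleftrightarrow>
     (\<exists>\<epsilon>>0. (\<forall>s. t - \<epsilon> < s \<and> s < t \<longrightarrow> F_inf \<rho> x0 s > s / \<alpha>) \<and>
            (\<forall>s. t < s \<and> s < t + \<epsilon> \<longrightarrow> F_inf \<rho> x0 s < s / \<alpha>))"

definition C1 :: "real \<Rightarrow> real \<Rightarrow> real set" where
  "C1 \<rho> \<alpha> = {tcross \<rho> \<alpha> x0 | x0. is_LCP \<rho> \<alpha> x0 (tcross \<rho> \<alpha> x0)}"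

definition dfun :: "real \<Rightarrow> real \<Rightarrow> real \<Rightarrow> real \<Rightarrow> real" where
  "dfun \<rho> \<alpha> x0 u = 1 - Phi (u / sqrt (1 - \<rho>) + sqrt (\<rho> / (1 - \<rho>)) * x0) - (1 - Phi u) / \<alpha>"

definition u2 :: "real \<Rightarrow> real \<Rightarrow> real \<Rightarrow> real" where
  "u2 \<rho> \<alpha> x0 = - x0 / sqrt \<rho> - sqrt ((1 - \<rho>) / \<rho>) * sqrt (x0\<^sup>2 - 2 * ln (sqrt (1 - \<rho>) / \<alpha>))"

text \<open>The (unique) tangent point x0*: u2(x0*) real and d(u2(x0*) | x0*, 1) = 0.\<close>
definition x0_star :: "real \<Rightarrow> real \<Rightarrow> real" where
  "x0_star \<rho> \<alpha> = (THE x0. x0\<^sup>2 - 2 * ln (sqrt (1 - \<rho>) / \<alpha>) \<ge> 0 \<and>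
                          dfun \<rho> \<alpha> x0 (u2 \<rho> \<alpha> x0) = 0)"

definition t2 :: "real \<Rightarrow> real \<Rightarrow> real" where
  "t2 \<rho> \<alpha> = 1 - Phi (u2 \<rho> \<alpha> (x0_star \<rho> \<alpha>))"

definition order_stat :: "(nat \<Rightarrow> real) \<Rightarrow> nat \<Rightarrow> nat \<Rightarrow> real" where
  "order_stat p n i = sort (map p [1..<n+1]) ! (i - 1)"

definition lsu_m :: "real \<Rightarrow> nat \<Rightarrow> (nat \<Rightarrow> real) \<Rightarrow> nat" where
  "lsu_m \<alpha> n p = (let S = {i \<in> {1..n}. order_stat p n i \<le> real i * \<alpha> / real n}
                    in if S = {} then 0 else Max S)"

definition lsu_rejected :: "real \<Rightarrow> nat \<Rightarrow> (nat \<Rightarrow> real) \<Rightarrow> nat set" where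
  "lsu_rejected \<alpha> n p = {i \<in> {1..n}. p i \<le> real (lsu_m \<alpha> n p) * \<alpha> / real n}"

text \<open>p-values in model D-EX-N: true hypotheses (indices in Tr) have theta = 0,
  the others theta = infinity, i.e. p-value 0.\<close>
definition pval :: "real \<Rightarrow> (nat \<Rightarrow> 'a \<Rightarrow> real) \<Rightarrow> nat set \<Rightarrow> 'a \<Rightarrow> nat \<Rightarrow> real" where
  "pval \<rho> X Tr \<omega> i =
     (if i \<in> Tr then 1 - Phi (sqrt (1 - \<rho>) * X i \<omega> - sqrt \<rho> * X 0 \<omega>) else 0)"

definition Vn :: "real \<Rightarrow> real \<Rightarrow> (nat \<Rightarrow> 'a \<Rightarrow> real) \<Rightarrow> nat set \<Rightarrow> nat \<Rightarrow> 'a \<Rightarrow> nat" where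
  "Vn \<alpha> \<rho> X Tr n \<omega> = card (lsu_rejected \<alpha> n (pval \<rho> X Tr \<omega>) \<inter> Tr)"

definition Rn :: "real \<Rightarrow> real \<Rightarrow> (nat \<Rightarrow> 'a \<Rightarrow> real) \<Rightarrow> nat set \<Rightarrow> nat \<Rightarrow> 'a \<Rightarrow> nat" where
  "Rn \<alpha> \<rho> X Tr n \<omega> = card (lsu_rejected \<alpha> n (pval \<rho> X Tr \<omega>))"

end

theory Submission
  imports Defs
begin

text \<open>
  Write \<open>d(u | x)\<close> for the difference between the limiting conditional c.d.f. and the line
  \<open>t / \<alpha>\<close> at \<open>t = 1 - \<Phi>(u)\<close>. It decreases strictly in \<open>x\<close>, and in \<open>u\<close> its derivative has the
  sign of a quadratic polynomial: \<open>d\<close> increases up to \<open>u2(x)\<close>, decreases up to the other root \<open>u1(x)\<close>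
  and then increases to \<open>0\<close>. So a nonnegative value of \<open>d(\<sqdot> | x)\<close> is at most \<open>d(u2(x) | x)\<close>, which
  makes the maximum of the crossing level \<open>x0\<close> the unique tangent point and shows that below this
  level the largest crossing point lies to the right of \<open>t2\<close> and is the inverse of \<open>x0\<close> there.

  The \<open>p\<close>-value of a true hypothesis is at most \<open>t\<close> iff \<open>X\<^sub>i\<close> exceeds a threshold depending on \<open>X\<^sub>0\<close>
  only. Since the empirical distributions of \<open>(X\<^sub>i)\<close> converge at all thresholds simultaneously, almost
  surely, no conditioning on \<open>X\<^sub>0\<close> is needed: pathwise, \<open>R\<^sub>n / n\<close> tends to the largest crossing point
  divided by \<open>\<alpha>\<close>. Dominated convergence and the layer cake formula give the expected error rate.

  Where the crossing point is \<open>0\<close>, the ratio \<open>V\<^sub>n / R\<^sub>n\<close> is not determined by these limits. There one uses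
  \<open>1 / R\<^sub>n \<le> \<alpha> / (n p\<^sub>i)\<close> for each rejected \<open>p\<^sub>i\<close>, so that \<open>V\<^sub>n / R\<^sub>n\<close> is bounded by the average of
  \<open>1 / p\<^sub>i\<close> over the \<open>p\<^sub>i \<le> \<delta>\<close>, and \<open>1 / p\<^sub>i\<close> is integrable when \<open>X\<^sub>0\<close> is bounded below.
\<close>

section \<open>The standard normal distribution function\<close>

lemma Phi_eq_cdf: "Phi = cdf std_normal_distribution"
proof
  fix x
  have "cdf std_normal_distribution x = (\<integral>t. indicator {..x} t \<partial>std_normal_distribution)"
    by (simp add: cdf_def)
  also have "\<dots> = (\<integral>t. std_normal_density t *\<^sub>R indicator {..x} t \<partial>lborel)"
    by (subst integral_density) auto
  also have "\<dots> = Phi x"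
    unfolding Phi_def set_lebesgue_integral_def by (intro Bochner_Integration.integral_cong) (auto simp: indicator_def)
  finally show "Phi x = cdf std_normal_distribution x" by simp
qed

text \<open>Rewriting the increment as a gauge integral over a compact interval makes the
  fundamental theorem of calculus available for \<open>Phi\<close>.\<close>

lemma Phi_diff:
  assumes "x \<le> y"
  shows "Phi y - Phi x = integral {x..y} std_normal_density"
proof -
  have i: "set_integrable lborel A std_normal_density" if "A \<in> sets lborel" for A
    using integrable_mult_indicator[of A lborel std_normal_density] that
    by (simp add: set_integrable_def)
  have "{..y} = {..x} \<union> {x<..y}" using assms by auto
  then have "Phi y = Phi x + (LBINT t:{x<..y}. std_normal_density t)"
    unfolding Phi_def by (simp only:) (rule set_integral_Un; use i in auto)
  also have "(LBINT t:{x<..y}. std_normal_density t) = integral {x<..y} std_normal_density"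
    by (rule set_borel_integral_eq_integral) (use i in auto)
  also have "\<dots> = integral {x..y} std_normal_density"
    by (rule integral_spike_set; rule negligible_subset[of "{x}"]) auto
  finally show ?thesis by simp
qed

lemma continuous_std_normal: "continuous_on A std_normal_density"
  unfolding std_normal_density_def by (intro continuous_intros) auto

lemma DERIV_Phi [derivative_intros]:
  assumes "(f has_real_derivative D) (at x within A)"
  shows "((\<lambda>x. Phi (f x)) has_real_derivative std_normal_density (f x) * D) (at x within A)"
proof -
  have "(Phi has_real_derivative std_normal_density x) (at x)" for x
  proof -
    \<comment> \<open>The base point \<open>x-1\<close> puts \<open>x\<close> in the interior of the
      interval, so that the derivative within the interval is a full derivative.\<close>
    have "((\<lambda>u. integral {x-1..u} std_normal_density) has_real_derivative std_normal_density x)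
        (at x within {x-1..x+1})"
      by (rule integral_has_real_derivative) (auto intro: continuous_std_normal)
    then have "((\<lambda>u. integral {x-1..u} std_normal_density) has_real_derivative std_normal_density x) (at x)"
      by (subst (asm) at_within_Icc_at) auto
    then have "((\<lambda>u. Phi (x-1) + integral {x-1..u} std_normal_density) has_real_derivative std_normal_density x) (at x)"
      using DERIV_add[OF DERIV_const] by fastforce
    moreover have "eventually (\<lambda>u. u \<in> {x-1<..}) (nhds x)"
      by (rule eventually_nhds_in_open) auto
    then have ev: "\<forall>\<^sub>F u in nhds x. Phi (x-1) + integral {x-1..u} std_normal_density = Phi u"
      by eventually_elim (simp flip: Phi_diff)
    ultimately show ?thesis
      using DERIV_cong_ev[OF refl ev refl] by fast
  qed
  from DERIV_chain2[OF this assms] show ?thesis .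
qed

lemma isCont_Phi [continuous_intros]: "isCont Phi x"
  using DERIV_Phi[OF DERIV_ident] by (rule DERIV_isCont)

lemma continuous_on_Phi [continuous_intros]:
  "continuous_on A f \<Longrightarrow> continuous_on A (\<lambda>x. Phi (f x))"
  using continuous_on_compose2[of UNIV Phi A f] isCont_Phi continuous_at_imp_continuous_on by blast

lemma borel_measurable_Phi [measurable]: "Phi \<in> borel_measurable borel"
  by (intro borel_measurable_continuous_onI continuous_intros)

lemma Phi_strict_mono: "x < y \<Longrightarrow> Phi x < Phi y"
  by (rule DERIV_pos_imp_increasing)
    (use DERIV_Phi[OF DERIV_ident] normal_density_pos[of 1 0] in \<open>fastforce+\<close>)

lemma Phi_less_iff [simp]: "Phi x < Phi y \<longleftrightarrow> x < y"
  using Phi_strict_mono[of x y] Phi_strict_mono[of y x] by (cases x y rule: linorder_cases) auto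

lemma Phi_le_iff [simp]: "Phi x \<le> Phi y \<longleftrightarrow> x \<le> y"
  using Phi_less_iff[of y x] by linarith

lemma Phi_eq_iff [simp]: "Phi x = Phi y \<longleftrightarrow> x = y"
  by (metis Phi_less_iff less_irrefl linorder_neqE)

interpretation std_normal: real_distribution std_normal_distribution
  by (rule real_dist_normal_dist)

lemma Phi_at_top: "(Phi \<longlongrightarrow> 1) at_top"
  using std_normal.cdf_lim_at_top_prob by (simp add: Phi_eq_cdf)

lemma Phi_at_bot: "(Phi \<longlongrightarrow> 0) at_bot"
  using std_normal.cdf_lim_at_bot by (simp add: Phi_eq_cdf)

text \<open>The weak bounds at \<open>x-1\<close> and \<open>x+1\<close> become strict at
  \<open>x\<close> by strict monotonicity.\<close>

lemma Phi_bounds [simp]: "0 < Phi x" "Phi x < 1"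
proof -
  have "0 \<le> Phi (x-1)" "Phi (x+1) \<le> 1"
    by (auto simp: Phi_eq_cdf std_normal.cdf_nonneg std_normal.cdf_bounded_prob)
  then show "0 < Phi x" "Phi x < 1"
    using Phi_strict_mono[of "x-1" x] Phi_strict_mono[of x "x+1"] by linarith+
qed

lemma Phi_surj:
  assumes "0 < p" "p < 1"
  obtains x where "Phi x = p"
proof -
  have "eventually (\<lambda>x. Phi x > p) at_top" "eventually (\<lambda>x. Phi x < p) at_bot"
    using order_tendstoD[OF Phi_at_top] order_tendstoD[OF Phi_at_bot] assms by auto
  then obtain a b where "Phi a < p" "p < Phi b"
    by (auto simp: eventually_at_top_linorder eventually_at_bot_linorder)
  moreover from this have "a \<le> b"
    by (metis Phi_less_iff less_imp_le order_less_trans)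
  ultimately obtain x where "Phi x = p"
    using IVT'[of Phi a p b] continuous_on_Phi[OF continuous_on_id, of "{a..b}"] by force
  then show ?thesis by (rule that)
qed

lemma Phi_inv_Phi [simp]: "Phi_inv (Phi x) = x"
  unfolding Phi_inv_def by (rule the_equality) auto

lemma Phi_Phi_inv: "0 < p \<Longrightarrow> p < 1 \<Longrightarrow> Phi (Phi_inv p) = p"
  by (metis Phi_surj Phi_inv_Phi)

lemma Phi_inv_less_iff: "0 < p \<Longrightarrow> p < 1 \<Longrightarrow> Phi_inv p < u \<longleftrightarrow> p < Phi u"
  using Phi_less_iff[of "Phi_inv p" u] by (simp add: Phi_Phi_inv)

lemma isCont_Phi_inv: 
  assumes "0 < p" "p < 1" shows "isCont Phi_inv p"
  using isCont_inverse_function[of 1 "Phi_inv p" Phi_inv Phi] isCont_Phi Phi_Phi_inv[OF assms] by auto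

lemma continuous_on_Phi_inv [continuous_intros]:
  "continuous_on A f \<Longrightarrow> (\<And>x. x \<in> A \<Longrightarrow> 0 < f x \<and> f x < 1) \<Longrightarrow> continuous_on A (\<lambda>x. Phi_inv (f x))"
  using continuous_on_compose2[of "{0<..<1}" Phi_inv A f] isCont_Phi_inv
  by (force intro: continuous_at_imp_continuous_on)

text \<open>By the mean value theorem the increment of \<open>Phi\<close> over the unit interval
  starting at \<open>\<bar>y\<bar>\<close> is a density value, and the density decreases there. This
  crude bound suffices later to control reciprocals of p-values.\<close>

lemma Phi_tail_ge: "std_normal_density (\<bar>y\<bar> + 1) \<le> 1 - Phi y"
proof -
  obtain z where z: "\<bar>y\<bar> < z" "z < \<bar>y\<bar> + 1" "Phi (\<bar>y\<bar> + 1) - Phi \<bar>y\<bar> = std_normal_density z"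
    using MVT2[of "\<bar>y\<bar>" "\<bar>y\<bar> + 1" Phi std_normal_density] DERIV_Phi[OF DERIV_ident] by auto
  have "std_normal_density (\<bar>y\<bar> + 1) \<le> std_normal_density z"
    unfolding std_normal_density_def using z
    by (intro mult_left_mono) (auto intro!: power_mono)
  also have "\<dots> \<le> 1 - Phi \<bar>y\<bar>" using z(3) Phi_bounds(2)[of "\<bar>y\<bar> + 1"] by linarith
  also have "\<dots> \<le> 1 - Phi y" by simp
  finally show ?thesis .
qed

section \<open>The tangent point\<close>

locale lsu_limit =
  fixes \<alpha> \<rho> :: real
  assumes \<alpha>: "0 < \<alpha>" "\<alpha> < 1" and \<rho>: "0 < \<rho>" "\<rho> < 1"
begin

definition r :: real where "r = sqrt \<rho>"
definition c :: real where "c = sqrt (1 - \<rho>)"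
text \<open>This is the radicand in \<open>u2\<close>: the derivative of \<open>d x\<close> vanishes
  where \<open>(r * u + x)\<^sup>2 = c\<^sup>2 * \<Delta> x\<close>.\<close>

definition \<Delta> :: "real \<Rightarrow> real" where "\<Delta> x = x\<^sup>2 - 2 * ln (c / \<alpha>)"
definition h :: "real \<Rightarrow> real" where "h u = x0_of \<rho> \<alpha> (1 - Phi u)"
abbreviation d :: "real \<Rightarrow> real \<Rightarrow> real" where "d x u \<equiv> dfun \<rho> \<alpha> x u"

lemma rc: "0 < r" "r < 1" "0 < c" "c < 1" "r\<^sup>2 + c\<^sup>2 = 1"
  using \<rho> by (auto simp: r_def c_def)

lemma sqrt_ratio: "sqrt ((1 - \<rho>) / \<rho>) = c / r" "sqrt (\<rho> / (1 - \<rho>)) = r / c"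
  by (simp_all add: r_def c_def real_sqrt_divide)

lemma d_eq: "d x u = 1 - Phi ((u + r * x) / c) - (1 - Phi u) / \<alpha>"
  unfolding dfun_def sqrt_ratio c_def[symmetric] by (simp add: add_divide_distrib)

lemma h_eq: "h u = (c * Phi_inv (1 - (1 - Phi u) / \<alpha>) - u) / r"
  unfolding h_def x0_of_def sqrt_ratio r_def[symmetric] by (simp add: diff_divide_distrib)

lemma u2_eq: "u2 \<rho> \<alpha> x = (- x - c * sqrt (\<Delta> x)) / r"
  unfolding u2_def sqrt_ratio r_def[symmetric] c_def[symmetric] \<Delta>_def by (simp add: diff_divide_distrib)

lemma d_strict_anti: "x < y \<Longrightarrow> d y u < d x u"
  unfolding d_eq using rc(1,3) by (simp add: divide_strict_right_mono)

text \<open>The conditional c.d.f. stays below 1, so where it reaches the line the line is below 1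
  too. This confines crossings to the range where \<open>h\<close> is meaningful.\<close>

lemma d_nonnegD: "0 \<le> d x u \<Longrightarrow> 1 - Phi u < \<alpha>"
proof -
  assume "0 \<le> d x u"
  then have "(1 - Phi u) / \<alpha> < 1"
    using Phi_bounds(1)[of "(u + r * x) / c"] unfolding d_eq by linarith
  then show ?thesis using \<alpha> by (simp add: field_simps)
qed

lemma crossing_level_bounds: "1 - Phi u < \<alpha> \<Longrightarrow> 0 < 1 - (1 - Phi u) / \<alpha> \<and> 1 - (1 - Phi u) / \<alpha> < 1"
  using \<alpha> by (auto simp: field_simps)

text \<open>By construction \<open>d\<close> vanishes at the level \<open>h u\<close>, and it
  decreases strictly in the level.\<close>

lemma d_h:
  assumes "1 - Phi u < \<alpha>"
  shows d_pos_iff: "0 < d x u \<longleftrightarrow> x < h u" and d_zero_iff: "d x u = 0 \<longleftrightarrow> x = h u"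
proof -
  have "(u + r * h u) / c = Phi_inv (1 - (1 - Phi u) / \<alpha>)"
    unfolding h_eq using rc(1,3) by simp
  then have z: "d (h u) u = 0"
    using crossing_level_bounds[OF assms] by (simp only: d_eq Phi_Phi_inv)
  show "0 < d x u \<longleftrightarrow> x < h u" "d x u = 0 \<longleftrightarrow> x = h u"
    using z d_strict_anti[of x "h u" u] d_strict_anti[of "h u" x u]
    by (cases x "h u" rule: linorder_cases; force)+
qed

section \<open>Monotonicity of the difference in the quantile variable\<close>

lemma DERIV_d:
  "(d x has_real_derivative (std_normal_density u / \<alpha> - std_normal_density ((u + r * x) / c) / c)) (at u)"
proof -
  have "((\<lambda>u. 1 - Phi ((u + r * x) / c) - (1 - Phi u) / \<alpha>) has_real_derivative
      0 - std_normal_density ((u + r * x) / c) * (1 / c) - (0 - std_normal_density u * 1) / \<alpha>) (at u)"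
    using DERIV_add[OF DERIV_ident DERIV_const]
    by (intro DERIV_diff DERIV_const DERIV_Phi DERIV_cdivide DERIV_ident) fastforce
  then show ?thesis by (simp add: d_eq[abs_def])
qed

text \<open>Both terms of the derivative are multiples of exponentials. Once the prefactors are
  absorbed by \<open>L\<close>, its sign is that of the difference of the exponents, which is
  quadratic in \<open>u\<close>.\<close>

lemma d_deriv_sign:
  fixes x u
  defines "D \<equiv> std_normal_density u / \<alpha> - std_normal_density ((u + r * x) / c) / c"
  shows "0 < D \<longleftrightarrow> c\<^sup>2 * \<Delta> x < (r * u + x)\<^sup>2" and "D < 0 \<longleftrightarrow> (r * u + x)\<^sup>2 < c\<^sup>2 * \<Delta> x"
proof -
  define v where "v = (u + r * x) / c"
  define L where "L = ln (c / \<alpha>)"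
  have e: "c / \<alpha> = exp L" using rc \<alpha> by (simp add: L_def)
  have eu: "exp (L - u\<^sup>2 / 2) = c / \<alpha> * exp (- u\<^sup>2 / 2)"
    using exp_add[of L "- u\<^sup>2 / 2"] e by simp
  have D: "D = (1 / (sqrt (2 * pi) * c)) * (exp (L - u\<^sup>2 / 2) - exp (- v\<^sup>2 / 2))"
    unfolding D_def std_normal_density_def v_def[symmetric] eu using rc \<alpha>
    by (simp add: right_diff_distrib)
  have "c\<^sup>2 * (v\<^sup>2 - u\<^sup>2 + 2 * L) = (u + r * x)\<^sup>2 - c\<^sup>2 * u\<^sup>2 + 2 * c\<^sup>2 * L"
    unfolding v_def using rc by (simp add: power_divide algebra_simps)
  \<comment> \<open>The last summand is the defect that vanishes because
    \<open>r\<^sup>2 + c\<^sup>2 = 1\<close>.\<close>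
  also have "\<dots> = (r * u + x)\<^sup>2 - c\<^sup>2 * \<Delta> x + (u\<^sup>2 - x\<^sup>2) * (1 - r\<^sup>2 - c\<^sup>2)"
    by (simp add: \<Delta>_def L_def power2_eq_square algebra_simps)
  finally have q: "c\<^sup>2 * (v\<^sup>2 - u\<^sup>2 + 2 * L) = (r * u + x)\<^sup>2 - c\<^sup>2 * \<Delta> x"
    using rc(5) by simp
  have p: "0 < 1 / (sqrt (2 * pi) * c)" "0 < c\<^sup>2" using rc by auto
  have "0 < D \<longleftrightarrow> - v\<^sup>2 / 2 < L - u\<^sup>2 / 2" "D < 0 \<longleftrightarrow> L - u\<^sup>2 / 2 < - v\<^sup>2 / 2"
    unfolding D using p(1) by (simp_all only: zero_less_mult_iff mult_less_0_iff) auto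
  then have "0 < D \<longleftrightarrow> 0 < v\<^sup>2 - u\<^sup>2 + 2 * L" "D < 0 \<longleftrightarrow> v\<^sup>2 - u\<^sup>2 + 2 * L < 0" by auto
  then show "0 < D \<longleftrightarrow> c\<^sup>2 * \<Delta> x < (r * u + x)\<^sup>2" "D < 0 \<longleftrightarrow> (r * u + x)\<^sup>2 < c\<^sup>2 * \<Delta> x"
    using q p(2) zero_less_mult_iff[of "c\<^sup>2" "v\<^sup>2 - u\<^sup>2 + 2 * L"]
      mult_less_0_iff[of "c\<^sup>2" "v\<^sup>2 - u\<^sup>2 + 2 * L"] by auto
qed

lemma continuous_on_d: "continuous_on A (d x)"
  using DERIV_d DERIV_isCont by (metis continuous_at_imp_continuous_on)

lemma d_increasing:
  assumes "u < v" "\<And>w. u < w \<Longrightarrow> w < v \<Longrightarrow> c\<^sup>2 * \<Delta> x < (r * w + x)\<^sup>2"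
  shows "d x u < d x v"
  by (rule DERIV_pos_imp_increasing_open[OF assms(1)])
    (use assms(2) DERIV_d d_deriv_sign(1) in blast, rule continuous_on_d)

lemma d_decreasing:
  assumes "u < v" "\<And>w. u < w \<Longrightarrow> w < v \<Longrightarrow> (r * w + x)\<^sup>2 < c\<^sup>2 * \<Delta> x"
  shows "d x v < d x u"
  by (rule DERIV_neg_imp_decreasing_open[OF assms(1)])
    (use assms(2) DERIV_d d_deriv_sign(2) in blast, rule continuous_on_d)

lemma d_at_top: "(d x \<longlongrightarrow> 0) at_top"
proof -
  have "filterlim (\<lambda>u. 1 / c * (r * x + u)) at_top at_top"
    using rc by (intro filterlim_tendsto_pos_mult_at_top[OF tendsto_const]
      filterlim_tendsto_add_at_top[OF tendsto_const] filterlim_ident) auto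
  also have "(\<lambda>u. 1 / c * (r * x + u)) = (\<lambda>u. (u + r * x) / c)" by (simp add: add.commute)
  finally have "((\<lambda>u. Phi ((u + r * x) / c)) \<longlongrightarrow> 1) at_top"
    by (rule filterlim_compose[OF Phi_at_top])
  then have "((\<lambda>u. 1 - Phi ((u + r * x) / c) - (1 - Phi u) / \<alpha>) \<longlongrightarrow> 1 - 1 - (1 - 1) / \<alpha>) at_top"
    using \<alpha> by (intro tendsto_intros Phi_at_top) auto
  then show ?thesis by (simp add: d_eq[abs_def])
qed

text \<open>Under the assumption \<open>d x\<close> increases strictly from \<open>u\<close> on, and
  it tends to 0, so it approaches 0 from below.\<close>

lemma d_negI:
  assumes "\<And>w. u < w \<Longrightarrow> c\<^sup>2 * \<Delta> x < (r * w + x)\<^sup>2"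
  shows "d x u < 0"
proof -
  have inc: "d x v < d x w" if "u \<le> v" "v < w" for v w
    using that assms by (intro d_increasing) auto
  have "eventually (\<lambda>v. d x (u + 1) \<le> d x v) at_top"
    using eventually_ge_at_top[of "u + 2"] by eventually_elim (auto intro!: less_imp_le inc)
  then have "d x (u + 1) \<le> 0"
    by (intro tendsto_lowerbound[OF d_at_top]) auto
  then show ?thesis using inc[of u "u+1"] by simp
qed

text \<open>The larger critical point, the partner of \<open>u2\<close>; it has this meaning only
  for \<open>0 \<le> \<Delta> x\<close>.\<close>

definition u1 :: "real \<Rightarrow> real" where "u1 x = (- x + c * sqrt (\<Delta> x)) / r"

lemma abs_quadratic:
  assumes "0 \<le> \<Delta> x"
  shows "c\<^sup>2 * \<Delta> x < (r * w + x)\<^sup>2 \<longleftrightarrow> w < u2 \<rho> \<alpha> x \<or> u1 x < w"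
    and "(r * w + x)\<^sup>2 < c\<^sup>2 * \<Delta> x \<longleftrightarrow> u2 \<rho> \<alpha> x < w \<and> w < u1 x"
proof -
  have e: "c\<^sup>2 * \<Delta> x = (c * sqrt (\<Delta> x))\<^sup>2" using assms by (simp add: power_mult_distrib)
  have n: "0 \<le> c * sqrt (\<Delta> x)" using assms rc by simp
  have "c\<^sup>2 * \<Delta> x < (r * w + x)\<^sup>2 \<longleftrightarrow> c * sqrt (\<Delta> x) < \<bar>r * w + x\<bar>"
    unfolding e abs_le_square_iff[symmetric] not_le[symmetric] using n by simp
  also have "\<dots> \<longleftrightarrow> w < u2 \<rho> \<alpha> x \<or> u1 x < w"
    unfolding u2_eq u1_def using rc by (auto simp: field_simps)
  finally show "c\<^sup>2 * \<Delta> x < (r * w + x)\<^sup>2 \<longleftrightarrow> w < u2 \<rho> \<alpha> x \<or> u1 x < w" .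
  have "(r * w + x)\<^sup>2 < c\<^sup>2 * \<Delta> x \<longleftrightarrow> \<bar>r * w + x\<bar> < c * sqrt (\<Delta> x)"
    unfolding e abs_le_square_iff[symmetric] not_le[symmetric] using n by simp
  also have "\<dots> \<longleftrightarrow> u2 \<rho> \<alpha> x < w \<and> w < u1 x"
    unfolding u2_eq u1_def using rc by (auto simp: field_simps)
  finally show "(r * w + x)\<^sup>2 < c\<^sup>2 * \<Delta> x \<longleftrightarrow> u2 \<rho> \<alpha> x < w \<and> w < u1 x" .
qed

lemma d_neg_right: "0 \<le> \<Delta> x \<Longrightarrow> u1 x \<le> u \<Longrightarrow> d x u < 0"
  by (rule d_negI) (simp add: abs_quadratic)

lemma d_incr_left: "0 \<le> \<Delta> x \<Longrightarrow> u < v \<Longrightarrow> v \<le> u2 \<rho> \<alpha> x \<Longrightarrow> d x u < d x v"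
  by (rule d_increasing) (simp_all add: abs_quadratic)

lemma d_decr_mid: "0 \<le> \<Delta> x \<Longrightarrow> u2 \<rho> \<alpha> x \<le> u \<Longrightarrow> u < v \<Longrightarrow> v \<le> u1 x \<Longrightarrow> d x v < d x u"
  by (rule d_decreasing) (simp_all add: abs_quadratic)

text \<open>Without real critical points \<open>d x\<close> would increase to 0 and be negative
  throughout. With them it is negative from \<open>u1 x\<close> on, and to the left of
  \<open>u1 x\<close> its strict maximum is at \<open>u2\<close>.\<close>

lemma d_nonneg_shape:
  assumes "0 \<le> d x v"
  shows "0 \<le> \<Delta> x" "v < u1 x" "v \<noteq> u2 \<rho> \<alpha> x \<Longrightarrow> d x v < d x (u2 \<rho> \<alpha> x)"
proof -
  show *: "0 \<le> \<Delta> x"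
  proof (rule ccontr)
    assume "\<not> 0 \<le> \<Delta> x"
    then have "c\<^sup>2 * \<Delta> x < 0" using rc by (simp add: mult_less_0_iff)
    then have "d x v < 0" by (intro d_negI) (meson order_less_le_trans zero_le_power2)
    then show False using assms by simp
  qed
  show "v < u1 x" using d_neg_right[OF *, of v] assms by force
  then show "v \<noteq> u2 \<rho> \<alpha> x \<Longrightarrow> d x v < d x (u2 \<rho> \<alpha> x)"
    using d_incr_left[OF *, of v "u2 \<rho> \<alpha> x"] d_decr_mid[OF *, of "u2 \<rho> \<alpha> x" v] by force
qed

text \<open>A superlevel set of \<^const>\<open>h\<close> is compact, because the argument of the inverse c.d.f. in \<^const>\<open>h\<close>
  lies below the level of \<open>u\<close>, whence \<open>h u < - (1 - c) / r * u\<close>.\<close>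
lemma h_attains_max: "\<exists>us. 1 - Phi us < \<alpha> \<and> (\<forall>u. 1 - Phi u < \<alpha> \<longrightarrow> h u \<le> h us)"
proof -
  define ua where "ua = Phi_inv (1 - \<alpha>)"
  have ua: "1 - Phi u < \<alpha> \<longleftrightarrow> ua < u" for u
    unfolding ua_def using \<alpha> by (subst Phi_inv_less_iff) auto
  \<comment> \<open>Any level attained by \<open>h\<close> would do; it makes the superlevel set
    nonempty.\<close>
  define x where "x = h (ua + 1)"
  define K where "K = {u. 0 \<le> d x u}"
  have K: "K = {u. ua < u \<and> x \<le> h u}"
  proof -
    have "0 \<le> d x u \<longleftrightarrow> ua < u \<and> x \<le> h u" for u
    proof (cases "ua < u")
      case True
      then have lev: "1 - Phi u < \<alpha>" by (simp only: ua)
      show ?thesis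
        using d_pos_iff[OF lev, of x] d_zero_iff[OF lev, of x] True by linarith
    next
      case False
      then have "\<not> 1 - Phi u < \<alpha>" using ua by blast
      then show ?thesis using d_nonnegD[of x u] False by blast
    qed
    then show ?thesis by (simp add: K_def)
  qed
  \<comment> \<open>Closedness is read off from \<open>d\<close>, which is continuous on the whole
    line, whereas \<open>h\<close> is controlled only to the right of \<open>ua\<close>.\<close>
  have "closed K"
    unfolding K_def by (intro closed_Collect_le continuous_on_d) auto
  moreover have "bounded K"
  proof -
    have "u \<in> {ua..- x * r / (1 - c)}" if "u \<in> K" for u
    proof -
      have u: "ua < u" "x \<le> h u" using that K by auto
      let ?p = "1 - (1 - Phi u) / \<alpha>"
      have p: "0 < ?p" "?p < 1" using crossing_level_bounds ua u(1) by auto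
      have "?p < Phi u" using \<alpha> Phi_bounds(2)[of u] mult_strict_right_mono[of \<alpha> 1 "1 - Phi u"]
        by (simp add: field_simps)
      then have "Phi_inv ?p < u" using Phi_inv_less_iff p by blast
      then have "r * h u < c * u - u" unfolding h_eq using rc by simp
      moreover have "r * x \<le> r * h u" using u rc by simp
      ultimately have "u * (1 - c) \<le> - x * r" by (simp add: algebra_simps)
      then have "u \<le> - x * r / (1 - c)" using rc(4) by (subst pos_le_divide_eq) auto
      then show ?thesis using u by simp
    qed
    then show ?thesis by (meson bounded_closed_interval bounded_subset subsetI)
  qed
  ultimately have "compact K" by (simp add: compact_eq_bounded_closed)
  moreover have "ua + 1 \<in> K" unfolding K x_def by simp
  moreover have "continuous_on K h"
  proof -
    have "0 < 1 - (1 - Phi u) / \<alpha> \<and> 1 - (1 - Phi u) / \<alpha> < 1" if "u \<in> K" for u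
      using crossing_level_bounds[of u] that ua[of u] K by simp
    then show ?thesis
      unfolding h_eq[abs_def] using rc(1) \<alpha>
      by (intro continuous_on_divide continuous_on_diff continuous_on_mult continuous_on_const
          continuous_on_id continuous_on_Phi_inv continuous_on_Phi) auto
  qed
  ultimately obtain us where us: "us \<in> K" "\<forall>u\<in>K. h u \<le> h us"
    using continuous_attains_sup[of K h] by blast
  have "h u \<le> h us" if "ua < u" for u
    using us that by (cases "u \<in> K") (auto simp: K)
  with us show ?thesis using ua K by (intro exI[of _ us]) auto
qed

section \<open>The tangent level as the maximal crossing level\<close>

abbreviation xs :: real where "xs \<equiv> x0_star \<rho> \<alpha>"
abbreviation us :: real where "us \<equiv> u2 \<rho> \<alpha> xs"

text \<open>At the maximal level of \<open>h\<close> the difference is nowhere positive and vanishes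
  at the maximizer, which must then be \<open>u2\<close>. Of two distinct tangent levels, the
  smaller one would have a positive difference at the tangent point of the larger one, so the
  tangent level is unique.\<close>

lemma xs_props: 
  shows d_xs_us: "d xs us = 0" and d_xs_neg: "u \<noteq> us \<Longrightarrow> d xs u < 0"
proof -
  obtain u0 where u0: "1 - Phi u0 < \<alpha>" "\<And>u. 1 - Phi u < \<alpha> \<Longrightarrow> h u \<le> h u0"
    using h_attains_max by blast
  define x where "x = h u0"
  have z: "d x u0 = 0" using d_zero_iff[OF u0(1)] by (simp add: x_def)
  have le: "d x u \<le> 0" for u
    using d_pos_iff[of u x] d_nonnegD[of x u] u0(2)[of u] unfolding x_def by force
  have u0_eq: "u0 = u2 \<rho> \<alpha> x" using d_nonneg_shape(3)[of x u0] z le[of "u2 \<rho> \<alpha> x"] by force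
  have neg: "d x u < 0" if "u \<noteq> u0" for u
    using d_nonneg_shape(3)[of x u] that le[of u0] u0_eq by force
  have uniq: "y = x" if y: "0 \<le> \<Delta> y" "d y (u2 \<rho> \<alpha> y) = 0" for y
  proof -
    have yle: "d y u \<le> 0" for u using d_nonneg_shape(3)[of y u] y(2) by force
    show "y = x"
    proof (cases x y rule: linorder_cases)
      case less
      then show ?thesis using d_strict_anti[OF less, of "u2 \<rho> \<alpha> y"] y(2) le[of "u2 \<rho> \<alpha> y"] by simp
    next
      case greater
      then show ?thesis using d_strict_anti[OF greater, of u0] z yle[of u0] by simp
    qed auto
  qed
  have "xs = x"
    unfolding x0_star_def
  proof (rule the_equality)
    show "x\<^sup>2 - 2 * ln (sqrt (1 - \<rho>) / \<alpha>) \<ge> 0 \<and> d x (u2 \<rho> \<alpha> x) = 0"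
      using d_nonneg_shape(1)[of x u0] z u0_eq by (simp add: \<Delta>_def c_def)
  qed (use uniq in \<open>auto simp: \<Delta>_def c_def\<close>)
  with z neg u0_eq show "d xs us = 0" "u \<noteq> us \<Longrightarrow> d xs u < 0" by auto
qed

lemma us_level: "1 - Phi us < \<alpha>" using d_xs_us d_nonnegD[of xs us] by simp

lemma h_us: "h us = xs" using d_xs_us d_zero_iff[OF us_level] by simp

lemma h_less_xs: "1 - Phi u < \<alpha> \<Longrightarrow> u \<noteq> us \<Longrightarrow> h u < xs"
  using d_h[of u xs] d_xs_neg[of u] by force

lemma d_neg_above: "xs < x \<Longrightarrow> d x u < 0"
  using d_strict_anti[of xs x u] d_xs_us d_xs_neg[of u] by (cases "u = us") auto

text \<open>Below the tangent level the difference is positive at \<open>us\<close>. To the left of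
  \<open>us\<close> it first increases up to \<open>u2\<close> and from there on decreases, staying
  above its value at \<open>us\<close>, so it changes sign exactly once. Beyond \<open>us\<close> it
  becomes negative again, hence the restriction in the last claim.\<close>

lemma d_root:
  assumes "x < xs"
  obtains a where "a < us" "d x a = 0" "\<And>u. u < a \<Longrightarrow> d x u < 0" "\<And>u. a < u \<Longrightarrow> u \<le> us \<Longrightarrow> 0 < d x u"
proof -
  let ?v = "u2 \<rho> \<alpha> x"
  have pos: "0 < d x us" using d_strict_anti[OF assms, of us] d_xs_us by simp
  have D: "0 \<le> \<Delta> x" "us < u1 x" and v: "0 < d x ?v"
    using d_nonneg_shape[of x us] pos by (auto, force)
  \<comment> \<open>At or left of \<open>Phi_inv (1 - \<alpha>)\<close> the line is at least 1, so
    \<open>d x b\<close> cannot be positive; the other argument of \<open>min\<close> keeps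
    \<open>b\<close> to the left of \<open>u2\<close>.\<close>
  define b where "b = min (?v - 1) (Phi_inv (1 - \<alpha>))"
  have "b \<le> Phi_inv (1 - \<alpha>)" by (simp add: b_def)
  then have "\<not> 1 - Phi b < \<alpha>" using Phi_inv_less_iff[of "1 - \<alpha>" b] \<alpha> by simp
  then have "d x b \<le> 0" using d_nonnegD[of x b] by force
  moreover have "b \<le> ?v" by (simp add: b_def)
  ultimately obtain a where a: "b \<le> a" "a \<le> ?v" "d x a = 0"
    using IVT'[of "d x" b 0 ?v] v continuous_on_d by force
  then have av: "a < ?v" using v by (metis less_irrefl order_le_less)
  have neg: "d x u < 0" if "u < a" for u using d_incr_left[OF D(1) that] a by simp
  have p: "0 < d x u" if "a < u" "u \<le> us" for u
  proof (cases "u \<le> ?v")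
    case True
    then show ?thesis using d_incr_left[OF D(1) that(1)] a by simp
  next
    case False
    then show ?thesis using d_decr_mid[OF D(1), of u us] that D(2) pos by (cases "u = us") auto
  qed
  have "a < us" using neg[of us] pos a(3) by (cases a us rule: linorder_cases) auto
  then show ?thesis using a(3) neg p by (intro that) auto
qed

end

section \<open>Largest crossing points\<close>

context lsu_limit begin

definition lvl :: "real \<Rightarrow> real" where "lvl t = Phi_inv (1 - t)"

lemma Phi_lvl: "0 < t \<Longrightarrow> t < 1 \<Longrightarrow> Phi (lvl t) = 1 - t"
  by (simp add: lvl_def Phi_Phi_inv)

lemma lvl_less_iff: "0 < t \<Longrightarrow> t < 1 \<Longrightarrow> lvl t < u \<longleftrightarrow> 1 - Phi u < t"
  unfolding lvl_def by (subst Phi_inv_less_iff) auto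

lemma less_lvl_iff: "0 < t \<Longrightarrow> t < 1 \<Longrightarrow> u < lvl t \<longleftrightarrow> t < 1 - Phi u"
  using Phi_less_iff[of u "lvl t"] Phi_lvl[of t] by linarith

lemma F_inf_eq_d: "0 < t \<Longrightarrow> t < 1 \<Longrightarrow> F_inf \<rho> x t = t / \<alpha> + d x (lvl t)"
  using Phi_lvl[of t] by (simp add: F_inf_def dfun_def lvl_def)

lemma h_lvl: "0 < t \<Longrightarrow> t < 1 \<Longrightarrow> h (lvl t) = x0_of \<rho> \<alpha> t"
  by (simp add: h_def Phi_lvl)

lemma F_inf_crossing:
  assumes "0 < t" "t < \<alpha>"
  shows F_inf_gt_iff: "t / \<alpha> < F_inf \<rho> x t \<longleftrightarrow> x < x0_of \<rho> \<alpha> t"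
    and F_inf_eq_iff: "F_inf \<rho> x t = t / \<alpha> \<longleftrightarrow> x = x0_of \<rho> \<alpha> t"
proof -
  have t: "t < 1" using assms \<alpha> by simp
  have "1 - Phi (lvl t) < \<alpha>" using assms t by (simp add: Phi_lvl)
  from d_h[OF this, of x]
  show "t / \<alpha> < F_inf \<rho> x t \<longleftrightarrow> x < x0_of \<rho> \<alpha> t" "F_inf \<rho> x t = t / \<alpha> \<longleftrightarrow> x = x0_of \<rho> \<alpha> t"
    using F_inf_eq_d[of t x] h_lvl[of t] assms(1) t by auto
qed

abbreviation tt :: real where "tt \<equiv> t2 \<rho> \<alpha>"

lemma t2_bounds: "0 < tt" "tt < \<alpha>" "tt < 1"
  using us_level Phi_bounds[of us] \<alpha> by (auto simp: t2_def)

lemma lvl_t2: "lvl tt = us" by (simp add: lvl_def t2_def)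

lemma x0_of_t2: "x0_of \<rho> \<alpha> tt = xs"
  using h_lvl[of tt] t2_bounds h_us lvl_t2 by simp

lemma x0_of_less:
  assumes "0 < t" "t < \<alpha>" "t \<noteq> tt"
  shows "x0_of \<rho> \<alpha> t < xs"
proof -
  have t: "t < 1" using assms \<alpha> by simp
  have "lvl t \<noteq> us" using Phi_lvl[of t] Phi_lvl[of tt] lvl_t2 t2_bounds assms t by force
  then show ?thesis
    using h_less_xs[of "lvl t"] assms t by (simp add: Phi_lvl h_lvl)
qed

text \<open>The substitution \<open>t = 1 - Phi u\<close> reverses the order: the leftmost root in
  \<open>u\<close> becomes the largest crossing in \<open>t\<close>, and \<open>us\<close> becomes
  \<open>tt\<close>.\<close>

lemma tcross_below:
  assumes "x < xs"
  shows "tt < tcross \<rho> \<alpha> x" "tcross \<rho> \<alpha> x < \<alpha>"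
    "F_inf \<rho> x (tcross \<rho> \<alpha> x) = tcross \<rho> \<alpha> x / \<alpha>"
    "\<And>t. tcross \<rho> \<alpha> x < t \<Longrightarrow> t < 1 \<Longrightarrow> F_inf \<rho> x t < t / \<alpha>"
    "\<And>t. tt \<le> t \<Longrightarrow> t < tcross \<rho> \<alpha> x \<Longrightarrow> t / \<alpha> < F_inf \<rho> x t"
proof -
  obtain a where a: "a < us" "d x a = 0" "\<And>u. u < a \<Longrightarrow> d x u < 0"
      "\<And>u. a < u \<Longrightarrow> u \<le> us \<Longrightarrow> 0 < d x u"
    by (rule d_root[OF assms]; blast)
  define T where "T = 1 - Phi a"
  have T: "tt < T" "T < \<alpha>" "0 < T" "T < 1"
    using a d_nonnegD[of x a] \<alpha> by (auto simp: T_def t2_def)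
  have lT: "lvl T = a" by (simp add: lvl_def T_def)
  have eq: "F_inf \<rho> x T = T / \<alpha>" using F_inf_eq_d[of T x] T lT a(2) by simp
  have gt: "F_inf \<rho> x t < t / \<alpha>" if "T < t" "t < 1" for t
  proof -
    have "lvl t < a" using lvl_less_iff[of t a] that T unfolding T_def by simp
    then show ?thesis using F_inf_eq_d[of t x] a(3)[of "lvl t"] that T by simp
  qed
  have lt: "t / \<alpha> < F_inf \<rho> x t" if "tt \<le> t" "t < T" for t
  proof -
    have t: "0 < t" "t < 1" using that T t2_bounds by auto
    have "a < lvl t" using less_lvl_iff[OF t, of a] that unfolding T_def by simp
    moreover have "\<not> us < lvl t" using less_lvl_iff[OF t, of us] that unfolding t2_def by simp
    ultimately show ?thesis using F_inf_eq_d[OF t, of x] a(4)[of "lvl t"] by simp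
  qed
  have "tcross \<rho> \<alpha> x = T"
    unfolding tcross_def
  proof (rule cSup_eq_maximum)
    show "T \<in> {t \<in> {0..\<alpha>}. F_inf \<rho> x t = t / \<alpha>}" using eq T by simp
    fix t assume "t \<in> {t \<in> {0..\<alpha>}. F_inf \<rho> x t = t / \<alpha>}"
    then show "t \<le> T" using gt[of t] \<alpha> by force
  qed
  then show "tt < tcross \<rho> \<alpha> x" "tcross \<rho> \<alpha> x < \<alpha>"
    "F_inf \<rho> x (tcross \<rho> \<alpha> x) = tcross \<rho> \<alpha> x / \<alpha>"
    "\<And>t. tcross \<rho> \<alpha> x < t \<Longrightarrow> t < 1 \<Longrightarrow> F_inf \<rho> x t < t / \<alpha>"
    "\<And>t. tt \<le> t \<Longrightarrow> t < tcross \<rho> \<alpha> x \<Longrightarrow> t / \<alpha> < F_inf \<rho> x t"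
    using T eq gt lt by auto
qed

lemma F_inf_above:
  assumes "xs \<le> x" "0 < t" "t < 1" "xs < x \<or> t \<noteq> tt"
  shows "F_inf \<rho> x t < t / \<alpha>"
proof -
  have "lvl t \<noteq> us" if "t \<noteq> tt"
    using Phi_lvl[of t] Phi_lvl[of tt] lvl_t2 t2_bounds assms that by force
  then have "d x (lvl t) < 0"
    using assms d_neg_above[of x "lvl t"] d_xs_neg[of "lvl t"] by (cases "x = xs") auto
  then show ?thesis using F_inf_eq_d[of t x] assms by simp
qed

lemma tcross_above: "xs < x \<Longrightarrow> tcross \<rho> \<alpha> x = 0"
  unfolding tcross_def
proof (rule cSup_eq_maximum)
  show "0 \<in> {t \<in> {0..\<alpha>}. F_inf \<rho> x t = t / \<alpha>}" using \<alpha> by (simp add: F_inf_def)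
  fix t assume "xs < x" "t \<in> {t \<in> {0..\<alpha>}. F_inf \<rho> x t = t / \<alpha>}"
  then show "t \<le> 0" using F_inf_above[of x t] \<alpha> by force
qed

lemma tcross_at: "tcross \<rho> \<alpha> xs = tt"
  unfolding tcross_def
proof (rule cSup_eq_maximum)
  show "tt \<in> {t \<in> {0..\<alpha>}. F_inf \<rho> xs t = t / \<alpha>}"
    using t2_bounds F_inf_eq_iff[of tt xs] x0_of_t2 by simp
  fix t assume "t \<in> {t \<in> {0..\<alpha>}. F_inf \<rho> xs t = t / \<alpha>}"
  then show "t \<le> tt" using F_inf_above[of xs t] \<alpha> t2_bounds by force
qed

lemma tcross_bounds: "0 \<le> tcross \<rho> \<alpha> x" "tcross \<rho> \<alpha> x \<le> \<alpha>"
  using tcross_below(1,2)[of x] tcross_above[of x] tcross_at t2_bounds \<alpha>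
  by (cases x xs rule: linorder_cases; force)+

lemma tcross_x0_of:
  assumes "tt < t" "t < \<alpha>"
  shows "tcross \<rho> \<alpha> (x0_of \<rho> \<alpha> t) = t"
proof -
  let ?x = "x0_of \<rho> \<alpha> t"
  have x: "?x < xs" using x0_of_less[of t] assms t2_bounds by simp
  have "F_inf \<rho> ?x t = t / \<alpha>" using F_inf_eq_iff[of t ?x] assms t2_bounds by simp
  then show ?thesis
    using tcross_below(4,5)[OF x, of t] assms \<alpha> by (cases "tcross \<rho> \<alpha> ?x" t rule: linorder_cases) auto
qed

lemma is_LCP_below:
  assumes "x < xs"
  shows "is_LCP \<rho> \<alpha> x (tcross \<rho> \<alpha> x)"
  unfolding is_LCP_def
  using tcross_below[OF assms] \<alpha>
  by (intro exI[of _ "min (tcross \<rho> \<alpha> x - tt) (\<alpha> - tcross \<rho> \<alpha> x)"]) auto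

text \<open>To the left of 0 the c.d.f. is 0 by convention and the line is negative, so 0 meets the
  left-hand condition.\<close>

lemma is_LCP_above:
  assumes "xs < x"
  shows "is_LCP \<rho> \<alpha> x (tcross \<rho> \<alpha> x)"
  unfolding is_LCP_def tcross_above[OF assms]
proof (intro exI[of _ 1] conjI allI impI)
  show "s / \<alpha> < F_inf \<rho> x s" if "0 - 1 < s \<and> s < 0" for s
    using that \<alpha> by (simp add: F_inf_def divide_neg_pos)
  show "F_inf \<rho> x s < s / \<alpha>" if "0 < s \<and> s < 0 + 1" for s
    using that assms by (intro F_inf_above) auto
qed simp

text \<open>At the tangent level the c.d.f. only touches the line at \<open>tt\<close> and lies
  below it just to the left, so \<open>tt\<close> itself is excluded.\<close>

lemma not_is_LCP_at: "\<not> is_LCP \<rho> \<alpha> xs (tcross \<rho> \<alpha> xs)"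
proof
  assume "is_LCP \<rho> \<alpha> xs (tcross \<rho> \<alpha> xs)"
  then obtain \<epsilon> where e: "\<epsilon> > 0" "\<And>s. tt - \<epsilon> < s \<Longrightarrow> s < tt \<Longrightarrow> F_inf \<rho> xs s > s / \<alpha>"
    unfolding is_LCP_def tcross_at by blast
  \<comment> \<open>The bound \<open>tt / 2\<close> keeps \<open>s\<close> positive when
    \<open>\<epsilon>\<close> is large.\<close>
  define s where "s = max (tt - \<epsilon> / 2) (tt / 2)"
  have s: "tt - \<epsilon> < s" "s < tt" "0 < s" using e(1) t2_bounds by (auto simp: s_def)
  show False using e(2)[OF s(1,2)] F_inf_above[of xs s] s t2_bounds by simp
qed

text \<open>Levels below \<open>xs\<close> contribute the open interval, each of its points
  \<open>t\<close> being attained at the level \<open>x0_of \<rho> \<alpha> t\<close>; levels above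
  \<open>xs\<close> contribute 0; the level \<open>xs\<close> contributes nothing.\<close>

lemma C1_eq: "C1 \<rho> \<alpha> = {0} \<union> {tt<..<\<alpha>}"
proof
  show "C1 \<rho> \<alpha> \<subseteq> {0} \<union> {tt<..<\<alpha>}"
    unfolding C1_def
  proof
    fix t assume "t \<in> {tcross \<rho> \<alpha> x |x. is_LCP \<rho> \<alpha> x (tcross \<rho> \<alpha> x)}"
    then obtain x where t: "t = tcross \<rho> \<alpha> x" "is_LCP \<rho> \<alpha> x (tcross \<rho> \<alpha> x)" by blast
    then have "x \<noteq> xs" using not_is_LCP_at by blast
    then consider "x < xs" | "xs < x" by linarith
    then show "t \<in> {0} \<union> {tt<..<\<alpha>}"
      using tcross_below(1,2)[of x] tcross_above[of x] t(1) by cases auto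
  qed
  have "0 \<in> C1 \<rho> \<alpha>"
    unfolding C1_def using is_LCP_above[of "xs + 1"] tcross_above[of "xs + 1"]
    by (intro CollectI exI[of _ "xs + 1"]) auto
  moreover have "t \<in> C1 \<rho> \<alpha>" if "t \<in> {tt<..<\<alpha>}" for t
    unfolding C1_def using that is_LCP_below[of "x0_of \<rho> \<alpha> t"] x0_of_less[of t] tcross_x0_of[of t] t2_bounds
    by (intro CollectI exI[of _ "x0_of \<rho> \<alpha> t"]) auto
  ultimately show "{0} \<union> {tt<..<\<alpha>} \<subseteq> C1 \<rho> \<alpha>" by auto
qed

text \<open>This expresses the tail events of the crossing point as events on \<open>X 0\<close>, as
  the layer cake formula requires.\<close>

lemma less_tcross_iff:
  assumes "x \<noteq> xs" "tt \<le> t" "t < \<alpha>"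
  shows "t < tcross \<rho> \<alpha> x \<longleftrightarrow> x < x0_of \<rho> \<alpha> t"
proof (cases "x < xs")
  case True
  have t: "0 < t" "t < 1" using assms t2_bounds \<alpha> by auto
  show ?thesis
  proof (cases "t < tcross \<rho> \<alpha> x")
    case lt: True
    then show ?thesis
      using tcross_below(5)[OF True assms(2) lt] F_inf_gt_iff[OF t(1) assms(3)] by simp
  next
    case False
    then have "F_inf \<rho> x t \<le> t / \<alpha>"
      using tcross_below(3)[OF True] tcross_below(4)[OF True, of t] t
      by (cases "t = tcross \<rho> \<alpha> x") auto
    then show ?thesis using False F_inf_gt_iff[OF t(1) assms(3), of x] by simp
  qed
next
  case False
  then have "tcross \<rho> \<alpha> x = 0" "xs < x" using tcross_above[of x] assms by auto
  moreover have "x0_of \<rho> \<alpha> t \<le> xs"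
    using x0_of_less[of t] x0_of_t2 assms t2_bounds by (cases "t = tt") auto
  ultimately show ?thesis using assms t2_bounds by auto
qed

text \<open>Monotonicity is what yields Borel measurability. For two levels below \<open>xs\<close>,
  the larger one is the crossing level of its own crossing point, and \<open>less_tcross_iff\<close>
  applies to the smaller one.\<close>

lemma tcross_antimono: "x \<le> y \<Longrightarrow> tcross \<rho> \<alpha> y \<le> tcross \<rho> \<alpha> x"
proof -
  assume "x \<le> y"
  consider "x = y" | "xs < y" | "x < y" "y = xs" | "x < y" "y < xs" using \<open>x \<le> y\<close> by fastforce
  then show ?thesis
  proof cases
    case 4
    let ?t = "tcross \<rho> \<alpha> y"
    have "y = x0_of \<rho> \<alpha> ?t"
      using F_inf_eq_iff[of ?t y] tcross_below(1-3)[OF 4(2)] t2_bounds by linarith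
    then have "x < x0_of \<rho> \<alpha> ?t" using 4(1) by linarith
    moreover have "x \<noteq> xs" "tt \<le> ?t" "?t < \<alpha>" using 4 tcross_below(1,2)[OF 4(2)] by auto
    ultimately show ?thesis
      using less_tcross_iff[of x ?t] by linarith
  qed (use tcross_above[of y] tcross_bounds(1)[of x] tcross_below(1)[of x] tcross_at in auto)
qed

lemma borel_measurable_tcross [measurable]: "tcross \<rho> \<alpha> \<in> borel_measurable borel"
proof -
  have "mono (\<lambda>x. - tcross \<rho> \<alpha> x)" by (auto intro!: monoI tcross_antimono)
  then have "(\<lambda>x. - (- tcross \<rho> \<alpha> x)) \<in> borel_measurable borel"
    by (intro borel_measurable_uminus borel_measurable_mono)
  then show ?thesis by simp
qed

section \<open>Deterministic convergence of the rejection proportion\<close>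

lemma continuous_on_F_inf: "continuous_on {0<..<1} (F_inf \<rho> x)"
proof -
  have "continuous_on {0<..<1} (\<lambda>t. 1 - Phi (Phi_inv (1 - t) / sqrt (1 - \<rho>) + sqrt (\<rho> / (1 - \<rho>)) * x))"
    using \<rho> by (intro continuous_on_divide continuous_on_diff continuous_on_add continuous_on_const
        continuous_on_id continuous_on_Phi_inv continuous_on_Phi) auto
  then show ?thesis by (rule continuous_on_eq) (simp add: F_inf_def)
qed

text \<open>Here \<open>s n\<close> stands for the proportion of rejections and \<open>G n\<close> for the empirical c.d.f.
  of the \<open>p\<close>-values.\<close>
lemma rejection_proportion_limit:
  fixes G :: "nat \<Rightarrow> real \<Rightarrow> real" and s :: "nat \<Rightarrow> real"
  assumes x: "x \<noteq> xs"
    and mono: "\<And>n. mono (G n)"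
    and lim: "\<And>t. 0 < t \<Longrightarrow> t < 1 \<Longrightarrow> (\<lambda>n. G n t) \<longlonglongrightarrow> F_inf \<rho> x t"
    and s01: "\<And>n. 0 \<le> s n" "\<And>n. s n \<le> 1"
    and le: "\<And>n. s n \<le> G n (\<alpha> * s n)"
    and max: "\<And>n \<sigma>. 0 < n \<Longrightarrow> 0 < \<sigma> \<Longrightarrow> \<sigma> \<le> G n (\<alpha> * \<sigma>) \<Longrightarrow> \<sigma> \<le> s n"
  shows "s \<longlonglongrightarrow> tcross \<rho> \<alpha> x / \<alpha>"
proof (rule order_tendstoI)
  fix b assume b: "tcross \<rho> \<alpha> x / \<alpha> < b"
  then have tb: "tcross \<rho> \<alpha> x < \<alpha> * b"
    using \<alpha> by (simp add: pos_divide_less_eq mult.commute)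
  have b0: "0 < b" using b \<alpha> tcross_bounds(1)[of x] divide_nonneg_pos[of "tcross \<rho> \<alpha> x" \<alpha>] by linarith
  show "\<forall>\<^sub>F n in sequentially. s n < b"
  \<comment> \<open>Otherwise some subsequence stays at least \<open>b\<close> and, by compactness,
    converges to some \<open>l\<close>. In the limit
    \<open>l \<le> F_inf \<rho> x (\<alpha> * l)\<close>, which is impossible to the right of the
    largest crossing point.\<close>
  proof (rule ccontr)
    assume "\<not> ?thesis"
    from not_eventually_sequentiallyD[OF this]
    obtain q :: "nat \<Rightarrow> nat" where q: "strict_mono q" "\<And>n. b \<le> s (q n)"
      unfolding not_less by blast
    have "\<forall>n. (s \<circ> q) n \<in> {b..1}" using q s01 by simp
    then obtain l p where l: "l \<in> {b..1}" "strict_mono p" "((s \<circ> q) \<circ> p) \<longlonglongrightarrow> l"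
      using compact_Icc[of b 1, unfolded compact_def] by blast
    define k where "k = q \<circ> p"
    have k: "strict_mono k" "(\<lambda>n. s (k n)) \<longlonglongrightarrow> l"
      using l(2,3) q(1) by (auto simp: k_def o_def strict_mono_o[unfolded o_def])
    have "0 < \<alpha> * l" "\<alpha> * l \<le> \<alpha>" using l(1) b0 \<alpha> by (auto simp: mult_left_le)
    then have al: "0 < \<alpha> * l" "\<alpha> * l \<le> \<alpha>" "\<alpha> * l < 1" using \<alpha> by linarith+
    \<comment> \<open>The argument of \<open>G\<close> moves with \<open>n\<close> while convergence
      is only pointwise. Monotonicity allows it to be replaced by a fixed \<open>t\<close> beyond
      \<open>\<alpha> * l\<close>; afterwards \<open>t\<close> decreases to
      \<open>\<alpha> * l\<close>.\<close>
    have "l \<le> F_inf \<rho> x t" if t: "\<alpha> * l < t" "t < 1" for t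
    proof -
      have "0 < t" using t al by simp
      then have "(\<lambda>n. G (k n) t) \<longlonglongrightarrow> F_inf \<rho> x t"
        using LIMSEQ_subseq_LIMSEQ[OF lim k(1), of t] t by (simp add: o_def)
      moreover have "eventually (\<lambda>n. s (k n) \<le> G (k n) t) sequentially"
      proof -
        have "l < t / \<alpha>" using t \<alpha> by (simp add: field_simps)
        then have "eventually (\<lambda>n. s (k n) < t / \<alpha>) sequentially" using k(2) by (rule order_tendstoD(2)[rotated])
        then show ?thesis
        proof eventually_elim
          case (elim n)
          then have "\<alpha> * s (k n) \<le> t" using \<alpha> by (simp add: field_simps)
          then show ?case using le[of "k n"] monoD[OF mono, of "\<alpha> * s (k n)" t "k n"] by simp
        qed
      qed
      ultimately show ?thesis using tendsto_le[OF _ _ k(2)] by force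
    qed
    then have "eventually (\<lambda>t. l \<le> F_inf \<rho> x t) (at_right (\<alpha> * l))"
      using al(3) by (auto simp: eventually_at_right_field)
    moreover have "isCont (F_inf \<rho> x) (\<alpha> * l)"
      using continuous_on_F_inf[of x] al by (simp add: continuous_on_eq_continuous_at)
    then have "(F_inf \<rho> x \<longlongrightarrow> F_inf \<rho> x (\<alpha> * l)) (at_right (\<alpha> * l))"
      by (simp add: isCont_def filterlim_at_split)
    ultimately have "\<alpha> * l / \<alpha> \<le> F_inf \<rho> x (\<alpha> * l)"
      using \<alpha> by (auto intro!: tendsto_lowerbound)
    moreover have "tcross \<rho> \<alpha> x < \<alpha> * l"
      using tb l(1) \<alpha> by (auto intro: less_le_trans)
    then have "F_inf \<rho> x (\<alpha> * l) < \<alpha> * l / \<alpha>"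
      using tcross_below(4)[of x "\<alpha> * l"] F_inf_above[of x "\<alpha> * l"] al x
      by (cases x xs rule: linorder_cases) auto
    ultimately show False by simp
  qed
next
  fix b assume b: "b < tcross \<rho> \<alpha> x / \<alpha>"
  show "\<forall>\<^sub>F n in sequentially. b < s n"
  proof (cases "x < xs")
    case False
    then have "b < 0" using b x tcross_above[of x] by simp
    then have "b < s n" for n using s01(1)[of n] by linarith
    then show ?thesis by simp
  next
    case True
    let ?T = "tcross \<rho> \<alpha> x"
    \<comment> \<open>Just left of the crossing point the c.d.f. exceeds the line, so
      \<open>t / \<alpha>\<close> eventually satisfies the condition in the maximality
      assumption.\<close>
    define t where "t = (max (\<alpha> * b) tt + ?T) / 2"
    have "\<alpha> * b < ?T" using b \<alpha> by (simp add: field_simps)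
    then have t: "tt \<le> t" "t < ?T" "\<alpha> * b < t"
      using tcross_below(1)[OF True] by (auto simp: t_def)
    have t01: "0 < t" "t < 1" using t t2_bounds tcross_below(2)[OF True] \<alpha> by auto
    have "eventually (\<lambda>n. t / \<alpha> < G n t) sequentially"
      using order_tendstoD(1)[OF lim[OF t01]] tcross_below(5)[OF True t(1,2)] by blast
    then show ?thesis using eventually_gt_at_top[of 0]
    proof eventually_elim
      case (elim n)
      have "t / \<alpha> \<le> s n" using max[of n "t / \<alpha>"] elim t01 \<alpha> by simp
      moreover have "b < t / \<alpha>" using t(3) \<alpha> by (simp add: field_simps)
      ultimately show ?case by simp
    qed
  qed
qed

end

section \<open>The linear step-up procedure\<close>

lemma sorted_nth_le_iff:
  fixes t :: "'a :: linorder"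
  shows "sorted xs \<Longrightarrow> k < length xs \<Longrightarrow> xs ! k \<le> t \<longleftrightarrow> k < length (filter (\<lambda>x. x \<le> t) xs)"
proof (induction xs arbitrary: k)
  case (Cons x xs)
  show ?case
  proof (cases "x \<le> t")
    case True
    then show ?thesis using Cons by (cases k) auto
  next
    case False
    then have "\<not> y \<le> t" if "y \<in> set (x # xs)" for y using Cons.prems(1) that by auto
    then have "filter (\<lambda>x. x \<le> t) (x # xs) = []" by (auto simp: filter_empty_conv)
    moreover have "\<not> (x # xs) ! k \<le> t"
      using \<open>\<And>y. y \<in> set (x # xs) \<Longrightarrow> \<not> y \<le> t\<close> Cons.prems(2) nth_mem by blast
    ultimately show ?thesis by simp
  qed
qed simp

definition count_le :: "nat \<Rightarrow> (nat \<Rightarrow> real) \<Rightarrow> real \<Rightarrow> nat" where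
  "count_le n p t = card {i \<in> {1..n}. p i \<le> t}"

lemma count_le_mono: "s \<le> t \<Longrightarrow> count_le n p s \<le> count_le n p t"
  unfolding count_le_def by (intro card_mono) auto

lemma count_le_bound: "count_le n p t \<le> n"
  unfolding count_le_def by (rule order_trans[OF card_mono[of "{1..n}"]]) auto

lemma order_stat_le_iff:
  assumes "i \<in> {1..n}"
  shows "order_stat p n i \<le> t \<longleftrightarrow> i \<le> count_le n p t"
proof -
  have "length (filter (\<lambda>x. x \<le> t) (sort (map p [1..<n+1]))) = length (filter (\<lambda>i. p i \<le> t) [1..<n+1])"
    by (simp only: filter_sort length_sort filter_map length_map o_def)
  also have "\<dots> = card (set (filter (\<lambda>i. p i \<le> t) [1..<n+1]))"
    by (rule distinct_card[symmetric]) simp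
  also have "set (filter (\<lambda>i. p i \<le> t) [1..<n+1]) = {i \<in> {1..n}. p i \<le> t}" by auto
  finally have "length (filter (\<lambda>x. x \<le> t) (sort (map p [1..<n+1]))) = count_le n p t"
    by (simp only: count_le_def)
  \<comment> \<open>List positions start at 0, so the \<open>i\<close>-th order statistic has index
    \<open>i - 1\<close>.\<close>
  moreover have "i - 1 < length (sort (map p [1..<n+1]))" using assms by auto
  ultimately have "order_stat p n i \<le> t \<longleftrightarrow> i - 1 < count_le n p t"
    unfolding order_stat_def by (subst sorted_nth_le_iff) auto
  then show ?thesis using assms by auto
qed

text \<open>Adjoining 0 absorbs the case of no admissible index.\<close>

lemma lsu_m_eq_Max:
  "lsu_m \<alpha> n p = Max {i. i = 0 \<or> (i \<in> {1..n} \<and> i \<le> count_le n p (real i * \<alpha> / real n))}"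
proof -
  define S where "S = {i \<in> {1..n}. order_stat p n i \<le> real i * \<alpha> / real n}"
  have "S = {i \<in> {1..n}. i \<le> count_le n p (real i * \<alpha> / real n)}"
    unfolding S_def using order_stat_le_iff by blast
  then have "{i. i = 0 \<or> (i \<in> {1..n} \<and> i \<le> count_le n p (real i * \<alpha> / real n))} = insert 0 S" by auto
  moreover have "finite S" by (simp add: S_def)
  moreover have "lsu_m \<alpha> n p = (if S = {} then 0 else Max S)" unfolding lsu_m_def S_def Let_def by (rule refl)
  ultimately show ?thesis by simp
qed

lemma lsu_m_props:
  shows lsu_m_le: "lsu_m \<alpha> n p \<le> n"
    and lsu_m_le_count: "lsu_m \<alpha> n p \<le> count_le n p (real (lsu_m \<alpha> n p) * \<alpha> / real n)"
    and lsu_m_ge: "i \<in> {1..n} \<Longrightarrow> i \<le> count_le n p (real i * \<alpha> / real n) \<Longrightarrow> i \<le> lsu_m \<alpha> n p"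
proof -
  let ?S = "{i. i = 0 \<or> (i \<in> {1..n} \<and> i \<le> count_le n p (real i * \<alpha> / real n))}"
  have fin: "finite ?S" by (rule finite_subset[of _ "{0..n}"]) auto
  have "Max ?S \<in> ?S" by (rule Max_in[OF fin]) auto
  then have "lsu_m \<alpha> n p \<in> ?S" by (simp only: lsu_m_eq_Max)
  then show "lsu_m \<alpha> n p \<le> n"
    "lsu_m \<alpha> n p \<le> count_le n p (real (lsu_m \<alpha> n p) * \<alpha> / real n)" by auto
  show "i \<in> {1..n} \<Longrightarrow> i \<le> count_le n p (real i * \<alpha> / real n) \<Longrightarrow> i \<le> lsu_m \<alpha> n p"
    unfolding lsu_m_eq_Max by (rule Max_ge[OF fin]) simp
qed

text \<open>A real proportion is rounded up to the count \<open>k\<close> it produces: since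
  \<open>k\<close> is at least \<open>n * \<sigma>\<close>, the threshold grows and \<open>k\<close>
  is itself admissible.\<close>

lemma lsu_m_ge_real:
  assumes "0 < n" "0 < \<alpha>" "0 < \<sigma>" "\<sigma> \<le> real (count_le n p (\<alpha> * \<sigma>)) / real n"
  shows "\<sigma> \<le> real (lsu_m \<alpha> n p) / real n"
proof -
  define k where "k = count_le n p (\<alpha> * \<sigma>)"
  have k: "real n * \<sigma> \<le> real k" using assms by (simp add: k_def pos_le_divide_eq mult.commute)
  have "0 < real n * \<sigma>" using assms by simp
  then have "0 < k" using k by linarith
  moreover have "k \<le> n" by (simp add: k_def count_le_bound)
  moreover have "\<alpha> * \<sigma> \<le> real k * \<alpha> / real n"
    using mult_left_mono[OF k, of \<alpha>] assms by (simp add: pos_le_divide_eq mult_ac)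
  then have "k \<le> count_le n p (real k * \<alpha> / real n)"
    using count_le_mono unfolding k_def by blast
  ultimately have "k \<le> lsu_m \<alpha> n p" by (intro lsu_m_ge) auto
  then show ?thesis using k assms(1) by (simp add: pos_le_divide_eq mult.commute)
qed

text \<open>The number of p-values under the final threshold is itself an admissible index, so by
  maximality it cannot exceed \<open>lsu_m\<close>.\<close>

lemma card_lsu_rejected:
  assumes "0 \<le> \<alpha>"
  shows "card (lsu_rejected \<alpha> n p) = lsu_m \<alpha> n p"
proof -
  define k where "k = count_le n p (real (lsu_m \<alpha> n p) * \<alpha> / real n)"
  have ge: "lsu_m \<alpha> n p \<le> k" unfolding k_def by (rule lsu_m_le_count)
  have "k \<le> lsu_m \<alpha> n p"
  proof (cases "k = 0")
    case False
    have "real (lsu_m \<alpha> n p) * \<alpha> / real n \<le> real k * \<alpha> / real n"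
      using ge assms by (intro divide_right_mono mult_right_mono) auto
    then have "k \<le> count_le n p (real k * \<alpha> / real n)"
      using count_le_mono unfolding k_def by blast
    then show ?thesis using False count_le_bound[of n p] by (intro lsu_m_ge) (auto simp: k_def)
  qed simp
  then show ?thesis using ge by (simp add: lsu_rejected_def count_le_def k_def)
qed

text \<open>Hypotheses outside \<open>A\<close> are always rejected, so the false rejections are all
  rejections minus a deterministic number.\<close>

lemma card_lsu_rejected_true:
  assumes "0 \<le> \<alpha>" "A \<subseteq> {1..n}" "\<And>i. i \<in> {1..n} - A \<Longrightarrow> p i \<le> 0"
  shows "real (card (lsu_rejected \<alpha> n p \<inter> A)) = real (lsu_m \<alpha> n p) - (real n - real (card A))"
proof -
  let ?R = "lsu_rejected \<alpha> n p"
  have fin: "finite A" "finite ?R" using assms(2) finite_subset by (auto simp: lsu_rejected_def)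
  have "{1..n} - A \<subseteq> ?R"
  proof
    fix i assume i: "i \<in> {1..n} - A"
    have "p i \<le> 0" by (rule assms(3)[OF i])
    also have "0 \<le> real (lsu_m \<alpha> n p) * \<alpha> / real n" using assms(1) by simp
    finally show "i \<in> ?R" using i by (simp add: lsu_rejected_def)
  qed
  then have "?R = (?R \<inter> A) \<union> ({1..n} - A)" by (auto simp: lsu_rejected_def)
  then have "card ?R = card ((?R \<inter> A) \<union> ({1..n} - A))" by simp
  also have "\<dots> = card (?R \<inter> A) + card ({1..n} - A)"
    using fin by (intro card_Un_disjoint) auto
  also have "card ({1..n} - A) = n - card A" using fin assms(2) by (simp add: card_Diff_subset)
  finally have "lsu_m \<alpha> n p = card (?R \<inter> A) + (n - card A)"
    using card_lsu_rejected[OF assms(1)] by simp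
  moreover have "card A \<le> n" using card_mono[OF _ assms(2)] by simp
  ultimately show ?thesis by simp
qed

text \<open>A rejected \<open>p\<close>-value is at most \<open>\<alpha> R / n\<close>, so that \<open>1 / R \<le> \<alpha> / (n p)\<close>.\<close>
lemma false_discovery_proportion_le:
  assumes "0 < n" "0 < \<alpha>" "A \<subseteq> {1..n}" "\<And>i. i \<in> A \<Longrightarrow> 0 < p i"
    and small: "\<alpha> * (real (lsu_m \<alpha> n p) / real n) \<le> \<delta>"
  shows "real (card (lsu_rejected \<alpha> n p \<inter> A)) / max 1 (real (lsu_m \<alpha> n p))
    \<le> \<alpha> / real n * (\<Sum>i\<in>A. if p i \<le> \<delta> then 1 / p i else 0)"
proof -
  let ?R = "lsu_rejected \<alpha> n p" and ?m = "real (lsu_m \<alpha> n p)"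
  let ?f = "\<lambda>i. \<alpha> / real n * (if p i \<le> \<delta> then 1 / p i else 0)"
  have fin: "finite A" using assms(3) finite_subset by blast
  have "real (card (?R \<inter> A)) / max 1 ?m = (\<Sum>i\<in>?R \<inter> A. 1 / max 1 ?m)" by simp
  also have "\<dots> \<le> (\<Sum>i\<in>?R \<inter> A. ?f i)"
  proof (rule sum_mono)
    fix i assume i: "i \<in> ?R \<inter> A"
    have p: "0 < p i" "p i \<le> ?m * \<alpha> / real n" using i assms(4) by (auto simp: lsu_rejected_def)
    then have "0 < ?m * \<alpha> / real n" by linarith
    then have m: "0 < ?m" using assms(1,2) by (simp add: zero_less_divide_iff zero_less_mult_iff)
    have "p i \<le> \<delta>" using p(2) small by (simp add: mult.commute)
    moreover have "1 / max 1 ?m \<le> \<alpha> / real n * (1 / p i)"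
      using p m assms(1,2) by (simp add: field_simps max_def)
    ultimately show "1 / max 1 ?m \<le> ?f i" by simp
  qed
  also have "\<dots> \<le> (\<Sum>i\<in>A. ?f i)"
    using fin assms(1,2,4) by (intro sum_mono2) (auto intro!: mult_nonneg_nonneg simp: less_imp_le)
  finally show ?thesis by (simp only: sum_distrib_left)
qed

lemma borel_measurable_lsu_m:
  assumes [measurable]: "\<And>i. i \<in> {1..n} \<Longrightarrow> (\<lambda>\<omega>. p \<omega> i) \<in> borel_measurable M"
  shows "(\<lambda>\<omega>. lsu_m \<alpha> n (p \<omega>)) \<in> measurable M (count_space UNIV)"
proof -
  have count: "count_le n (p \<omega>) t = (\<Sum>i\<in>{1..n}. if p \<omega> i \<le> t then 1 else 0)" for \<omega> t
  proof -
    have "{i \<in> {1..n}. p \<omega> i \<le> t} = {1..n} \<inter> {i. p \<omega> i \<le> t}" by auto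
    then show ?thesis by (simp add: count_le_def sum.If_cases)
  qed
  have [measurable]: "(\<lambda>\<omega>. count_le n (p \<omega>) t) \<in> measurable M (count_space UNIV)" for t
    unfolding count by measurable
  show ?thesis unfolding lsu_m_eq_Max by measurable
qed

section \<open>Almost sure limits\<close>

lemma measure_std_normal: "measure std_normal_distribution {..<y} = Phi y"
proof -
  have "AE x in std_normal_distribution. x \<noteq> y"
    using AE_lborel_singleton[of y] by (simp add: AE_density) (auto elim: eventually_mono)
  then have "measure std_normal_distribution {..<y} = measure std_normal_distribution {..y}"
    by (intro std_normal.finite_measure_eq_AE) auto
  then show ?thesis by (simp add: Phi_eq_cdf cdf_def)
qed

text \<open>Hoeffding's inequality bounds the deviation probabilities by a geometric sequence, and
  the Borel-Cantelli lemma turns summability into almost sure convergence.\<close>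

lemma (in prob_space) frequency_tendsto_prob:
  assumes indep: "indep_vars (\<lambda>_. borel) X (UNIV :: nat set)"
    and [measurable]: "A \<in> sets borel"
    and prob: "\<And>i. prob {\<omega> \<in> space M. X i \<omega> \<in> A} = q"
  shows "AE \<omega> in M. (\<lambda>n. real (card {i \<in> {1..n}. X i \<omega> \<in> A}) / real n) \<longlonglongrightarrow> q"
proof -
  have [measurable]: "random_variable borel (X i)" for i
    using indep by (simp add: indep_vars_def)
  define Y :: "nat \<Rightarrow> 'a \<Rightarrow> real" where "Y i \<omega> = indicator A (X i \<omega>)" for i \<omega>
  have [measurable]: "Y i \<in> borel_measurable M" for i unfolding Y_def by measurable
  have indepY: "indep_vars (\<lambda>_. borel) Y I" for I
  proof -
    have "indep_vars (\<lambda>_. borel) (\<lambda>i. indicator A \<circ> X i :: 'a \<Rightarrow> real) UNIV"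
      by (rule indep_vars_compose[OF indep]) auto
    moreover have "(\<lambda>i. indicator A \<circ> X i) = Y" by (simp add: Y_def fun_eq_iff)
    ultimately have "indep_vars (\<lambda>_. borel) Y UNIV" by simp
    then show ?thesis by (rule indep_vars_subset) simp
  qed
  have EY: "expectation (Y i) = q" for i
  proof -
    have "expectation (Y i) = expectation (indicator {\<omega> \<in> space M. X i \<omega> \<in> A})"
      by (intro Bochner_Integration.integral_cong) (auto simp: Y_def indicator_def)
    then show ?thesis using prob by simp
  qed
  have cardY: "real (card {i \<in> {1..n}. X i \<omega> \<in> A}) = (\<Sum>i\<in>{1..n}. Y i \<omega>)" for n \<omega>
  proof -
    have "{i \<in> {1..n}. X i \<omega> \<in> A} = {1..n} \<inter> {i. X i \<omega> \<in> A}" by auto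
    then show ?thesis by (simp add: Y_def indicator_def sum.If_cases)
  qed
  have close: "AE \<omega> in M. eventually (\<lambda>n. \<bar>(\<Sum>i\<in>{1..n}. Y i \<omega>) - real n * q\<bar> < real n * \<epsilon>) sequentially"
    if e: "0 < \<epsilon>" for \<epsilon> :: real
  proof -
    \<comment> \<open>For \<open>n = 0\<close> the deviation event would be the whole space and the
      Hoeffding exponent would divide by 0.\<close>
    define B where "B n = (if n = 0 then {} else
      {\<omega> \<in> space M. \<bar>(\<Sum>i\<in>{1..n}. Y i \<omega>) - real n * q\<bar> \<ge> real n * \<epsilon>})" for n
    have [measurable]: "B n \<in> sets M" for n unfolding B_def by simp
    have bound: "prob (B n) \<le> 2 * exp (- 2 * \<epsilon>\<^sup>2) ^ n" for n
    proof (cases "n = 0")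
      case False
      interpret Hoeffding_ineq M "{1..n}" Y "\<lambda>_. 0" "\<lambda>_. 1" "\<Sum>i\<in>{1..n}. expectation (Y i)"
        by unfold_locales (auto simp: indepY Y_def)
      have "prob (B n) \<le> 2 * exp (- 2 * (real n * \<epsilon>)\<^sup>2 / real n)"
        using Hoeffding_ineq_abs_ge[of "real n * \<epsilon>"] False e by (simp add: B_def EY)
      also have "- 2 * (real n * \<epsilon>)\<^sup>2 / real n = real n * (- 2 * \<epsilon>\<^sup>2)"
        using False by (simp add: power2_eq_square)
      finally show ?thesis by (simp only: exp_of_nat_mult)
    qed (simp add: B_def)
    have "summable (\<lambda>n. 2 * exp (- 2 * \<epsilon>\<^sup>2) ^ n)"
      using e by (intro summable_mult summable_geometric) simp
    then have "summable (\<lambda>n. prob (B n))"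
      by (rule summable_comparison_test'[where N = 0]) (use bound in auto)
    then have "AE \<omega> in M. eventually (\<lambda>n. \<omega> \<in> space M - B n) sequentially"
      by (intro borel_cantelli_AE1) (auto simp: less_top[symmetric])
    then show ?thesis
    proof (rule AE_mp, intro AE_I2 impI)
      fix \<omega> assume "\<omega> \<in> space M" "eventually (\<lambda>n. \<omega> \<in> space M - B n) sequentially"
      from this(2) eventually_gt_at_top[of 0]
      show "eventually (\<lambda>n. \<bar>(\<Sum>i\<in>{1..n}. Y i \<omega>) - real n * q\<bar> < real n * \<epsilon>) sequentially"
        by eventually_elim (auto simp: B_def not_le)
    qed
  qed
  \<comment> \<open>Restricting the tolerance to \<open>1 / real (Suc k)\<close> leaves countably
    many exceptional null sets.\<close>
  have "AE \<omega> in M. \<forall>k. eventually (\<lambda>n. \<bar>(\<Sum>i\<in>{1..n}. Y i \<omega>) - real n * q\<bar> < real n * (1 / real (Suc k))) sequentially"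
    unfolding AE_all_countable by (intro allI close) simp
  then show ?thesis
  proof (rule AE_mp, intro AE_I2 impI)
    fix \<omega>
    assume ev: "\<forall>k. eventually (\<lambda>n. \<bar>(\<Sum>i\<in>{1..n}. Y i \<omega>) - real n * q\<bar> < real n * (1 / real (Suc k))) sequentially"
    show "(\<lambda>n. real (card {i \<in> {1..n}. X i \<omega> \<in> A}) / real n) \<longlonglongrightarrow> q"
    proof (rule tendstoI)
      fix e :: real assume "0 < e"
      then obtain k where k: "1 / real (Suc k) < e" by (rule nat_approx_posE)
      show "\<forall>\<^sub>F n in sequentially. dist (real (card {i \<in> {1..n}. X i \<omega> \<in> A}) / real n) q < e"
        using ev[rule_format, of k] eventually_gt_at_top[of 0]
      proof eventually_elim
        case (elim n)
        have "(\<Sum>i\<in>{1..n}. Y i \<omega>) / real n - q = ((\<Sum>i\<in>{1..n}. Y i \<omega>) - real n * q) / real n"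
          using elim(2) by (simp add: diff_divide_distrib)
        then have "dist ((\<Sum>i\<in>{1..n}. Y i \<omega>) / real n) q = \<bar>(\<Sum>i\<in>{1..n}. Y i \<omega>) - real n * q\<bar> / real n"
          by (simp only: dist_real_def abs_divide abs_of_nat)
        also have "\<dots> < 1 / real (Suc k)"
          using elim by (simp only: pos_divide_less_eq of_nat_0_less_iff mult.commute)
        finally show ?case unfolding cardY using k by linarith
      qed
    qed
  qed
qed

section \<open>Pathwise limits in the model\<close>

locale dex_model = prob_space M + lsu_limit \<alpha> \<rho>
  for M :: "'a measure" and \<alpha> \<rho> :: real +
  fixes X :: "nat \<Rightarrow> 'a \<Rightarrow> real" and Tr :: "nat \<Rightarrow> nat set"
  assumes indep: "indep_vars (\<lambda>_. borel) X UNIV"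
    and distr: "\<And>i. distributed M lborel (X i) (\<lambda>x. ennreal (std_normal_density x))"
    and Tr: "\<And>n. Tr n \<subseteq> {1..n}"
    and Tr_lim: "(\<lambda>n. real (card (Tr n)) / real n) \<longlonglongrightarrow> 1"
begin

lemma X_measurable [measurable]: "X i \<in> borel_measurable M"
  using distributed_measurable[OF distr, of i] by simp

lemma distr_X: "distr M borel (X i) = std_normal_distribution"
proof -
  have "distr M borel (X i) = distr M lborel (X i)" by (rule distr_cong) auto
  then show ?thesis using distributed_distr_eq_density[OF distr] by simp
qed

lemma prob_X: "A \<in> sets borel \<Longrightarrow> prob {\<omega> \<in> space M. X i \<omega> \<in> A} = measure std_normal_distribution A"
  unfolding distr_X[of i, symmetric] by (subst measure_distr) (auto intro!: arg_cong[where f = prob])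

lemma AE_X_neq: "AE \<omega> in M. X i \<omega> \<noteq> y"
proof -
  have "AE x in std_normal_distribution. x \<noteq> y"
    using AE_lborel_singleton[of y] by (simp add: AE_density) (auto elim: eventually_mono)
  then show ?thesis unfolding distr_X[of i, symmetric] by (subst (asm) AE_distr_iff) auto
qed

text \<open>Rational thresholds give one common null set; monotonicity in \<open>y\<close> and
  continuity of \<open>Phi\<close> then cover all real thresholds. Uniformity of the null set
  matters because the threshold used later depends on \<open>X 0\<close>.\<close>

lemma empirical_tail_tendsto:
  "AE \<omega> in M. \<forall>y. (\<lambda>n. real (card {i \<in> {1..n}. y \<le> X i \<omega>}) / real n) \<longlonglongrightarrow> 1 - Phi y"
proof -
  have "prob {\<omega> \<in> space M. X i \<omega> \<in> {y..}} = 1 - Phi y" for i y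
  proof -
    have "{\<omega> \<in> space M. X i \<omega> \<in> {y..}} = space M - {\<omega> \<in> space M. X i \<omega> \<in> {..<y}}" by auto
    then show ?thesis using prob_X[of "{..<y}" i] by (simp add: prob_compl measure_std_normal)
  qed
  then have "AE \<omega> in M. (\<lambda>n. real (card {i \<in> {1..n}. X i \<omega> \<in> {y..}}) / real n) \<longlonglongrightarrow> 1 - Phi y" for y
    by (intro frequency_tendsto_prob indep) auto
  then have "AE \<omega> in M. \<forall>y\<in>\<rat>. (\<lambda>n. real (card {i \<in> {1..n}. X i \<omega> \<in> {y..}}) / real n) \<longlonglongrightarrow> 1 - Phi y"
    by (intro AE_ball_countable' countable_rat)
  then show ?thesis
  proof (rule AE_mp, intro AE_I2 impI allI)
    fix \<omega> y
    let ?B = "\<lambda>n y. real (card {i \<in> {1..n}. y \<le> X i \<omega>}) / real n"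
    assume "\<forall>y\<in>\<rat>. (\<lambda>n. real (card {i \<in> {1..n}. X i \<omega> \<in> {y..}}) / real n) \<longlonglongrightarrow> 1 - Phi y"
    then have rat: "(\<lambda>n. ?B n q) \<longlonglongrightarrow> 1 - Phi q" if "q \<in> \<rat>" for q using that by simp
    have anti: "?B n b \<le> ?B n a" if "a \<le> b" for n a b
      using that by (intro divide_right_mono of_nat_mono card_mono) auto
    show "(\<lambda>n. ?B n y) \<longlonglongrightarrow> 1 - Phi y"
    proof (rule order_tendstoI)
      fix a assume "a < 1 - Phi y"
      then have "eventually (\<lambda>q. Phi q < 1 - a) (at_right y)"
        using isCont_Phi[of y] by (intro order_tendstoD(2)[of _ "Phi y"]) (auto simp: isCont_def filterlim_at_split)
      then obtain b where "y < b" "\<And>q. y < q \<Longrightarrow> q < b \<Longrightarrow> Phi q < 1 - a"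
        by (auto simp: eventually_at_right_field)
      moreover obtain q where "q \<in> \<rat>" "y < q" "q < b" using Rats_dense_in_real[OF \<open>y < b\<close>] by blast
      ultimately have q: "q \<in> \<rat>" "y < q" "a < 1 - Phi q" by force+
      show "eventually (\<lambda>n. a < ?B n y) sequentially"
        using order_tendstoD(1)[OF rat[OF q(1)] q(3)]
        by eventually_elim (use anti[of y q] q(2) in \<open>auto intro: less_le_trans\<close>)
    next
      fix a assume "1 - Phi y < a"
      then have "eventually (\<lambda>q. 1 - a < Phi q) (at_left y)"
        using isCont_Phi[of y] by (intro order_tendstoD(1)[of _ "Phi y"]) (auto simp: isCont_def filterlim_at_split)
      then obtain b where "b < y" "\<And>q. b < q \<Longrightarrow> q < y \<Longrightarrow> 1 - a < Phi q"
        by (auto simp: eventually_at_left_field)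
      moreover obtain q where "q \<in> \<rat>" "b < q" "q < y" using Rats_dense_in_real[OF \<open>b < y\<close>] by blast
      ultimately have q: "q \<in> \<rat>" "q < y" "1 - Phi q < a" by force+
      show "eventually (\<lambda>n. ?B n y < a) sequentially"
        using order_tendstoD(2)[OF rat[OF q(1)] q(3)]
        by eventually_elim (use anti[of q y] q(2) in \<open>auto intro: le_less_trans\<close>)
    qed
  qed
qed

abbreviation p :: "nat \<Rightarrow> 'a \<Rightarrow> nat \<Rightarrow> real" where "p n \<omega> \<equiv> pval \<rho> X (Tr n) \<omega>"
abbreviation m :: "nat \<Rightarrow> 'a \<Rightarrow> nat" where "m n \<omega> \<equiv> lsu_m \<alpha> n (p n \<omega>)"

lemma card_Tr_le: "card (Tr n) \<le> n"
  using card_mono[OF _ Tr, of n] by simp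

text \<open>For true hypotheses the p-value condition is \<open>y \<le> X i \<omega>\<close> with a
  threshold fixed along the path; the remaining indices alter the count by at most
  \<open>n - card (Tr n)\<close>, which is negligible against \<open>n\<close>.\<close>

lemma ecdf_tendsto:
  assumes lim: "\<And>y. (\<lambda>n. real (card {i \<in> {1..n}. y \<le> X i \<omega>}) / real n) \<longlonglongrightarrow> 1 - Phi y"
    and t: "0 < t" "t < 1"
  shows "(\<lambda>n. real (count_le n (p n \<omega>) t) / real n) \<longlonglongrightarrow> F_inf \<rho> (X 0 \<omega>) t"
proof -
  define y where "y = (lvl t + r * X 0 \<omega>) / c"
  define B where "B n = {i \<in> {1..n}. y \<le> X i \<omega>}" for n
  have F: "F_inf \<rho> (X 0 \<omega>) t = 1 - Phi y"
    using t unfolding F_inf_def sqrt_ratio y_def lvl_def c_def[symmetric] by (simp add: add_divide_distrib)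
  have diff: "\<bar>real (count_le n (p n \<omega>) t) - real (card (B n))\<bar> \<le> real n - real (card (Tr n))" for n
  proof -
    define A where "A = {i \<in> {1..n}. p n \<omega> i \<le> t}"
    have iff: "i \<in> A \<longleftrightarrow> i \<in> B n" if "i \<in> Tr n" for i
    proof -
      have "p n \<omega> i = 1 - Phi (c * X i \<omega> - r * X 0 \<omega>)"
        using that by (simp add: pval_def c_def r_def)
      then have "p n \<omega> i \<le> t \<longleftrightarrow> \<not> (c * X i \<omega> - r * X 0 \<omega> < lvl t)"
        using less_lvl_iff[OF t, of "c * X i \<omega> - r * X 0 \<omega>"] by linarith
      also have "\<dots> \<longleftrightarrow> y \<le> X i \<omega>" unfolding y_def using rc by (auto simp: field_simps)
      finally show ?thesis by (simp add: A_def B_def)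
    qed
    have D: "card ({1..n} - Tr n) = n - card (Tr n)"
      using Tr[of n] by (simp add: card_Diff_subset finite_subset)
    have sub: "card C \<le> card C' + (n - card (Tr n))"
      if "C \<subseteq> C' \<union> ({1..n} - Tr n)" "finite C'" for C C' :: "nat set"
      using card_mono[OF _ that(1)] card_Un_le[of C' "{1..n} - Tr n"] that(2) D by simp
    have "A \<subseteq> B n \<union> ({1..n} - Tr n)" "B n \<subseteq> A \<union> ({1..n} - Tr n)" "finite A" "finite (B n)"
      using iff by (auto simp: A_def B_def)
    then have "card A \<le> card (B n) + (n - card (Tr n))" "card (B n) \<le> card A + (n - card (Tr n))"
      using sub by auto
    then show ?thesis using card_Tr_le[of n] unfolding count_le_def A_def[symmetric] by linarith
  qed
  have "(\<lambda>n. real (count_le n (p n \<omega>) t) / real n - real (card (B n)) / real n) \<longlonglongrightarrow> 0"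
  proof (rule tendsto_0_le[where K = 1 and f = "\<lambda>n. 1 - real (card (Tr n)) / real n"])
    show "(\<lambda>n. 1 - real (card (Tr n)) / real n) \<longlonglongrightarrow> 0"
      using tendsto_diff[OF tendsto_const Tr_lim, of 1] by simp
    show "\<forall>\<^sub>F n in sequentially. norm (real (count_le n (p n \<omega>) t) / real n - real (card (B n)) / real n)
        \<le> norm (1 - real (card (Tr n)) / real n) * 1"
      using eventually_gt_at_top[of 0]
    proof eventually_elim
      case (elim n)
      have "1 - real (card (Tr n)) / real n = (real n - real (card (Tr n))) / real n"
        using elim by (simp add: diff_divide_distrib)
      moreover have "\<bar>real (count_le n (p n \<omega>) t) - real (card (B n))\<bar> / real n \<le> (real n - real (card (Tr n))) / real n"
        by (intro divide_right_mono diff) simp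
      ultimately show ?case using elim card_Tr_le[of n]
        by (simp add: diff_divide_distrib[symmetric] abs_divide)
    qed
  qed
  from tendsto_add[OF this lim[of y, folded B_def]] show ?thesis by (simp add: F)
qed

lemma lsu_m_tendsto:
  assumes "\<And>y. (\<lambda>n. real (card {i \<in> {1..n}. y \<le> X i \<omega>}) / real n) \<longlonglongrightarrow> 1 - Phi y"
    and "X 0 \<omega> \<noteq> xs"
  shows "(\<lambda>n. real (m n \<omega>) / real n) \<longlonglongrightarrow> tcross \<rho> \<alpha> (X 0 \<omega>) / \<alpha>"
proof (rule rejection_proportion_limit[OF assms(2)])
  show "mono (\<lambda>t. real (count_le n (p n \<omega>) t) / real n)" for n
    by (intro monoI divide_right_mono of_nat_mono count_le_mono) auto
  show "(\<lambda>n. real (count_le n (p n \<omega>) t) / real n) \<longlonglongrightarrow> F_inf \<rho> (X 0 \<omega>) t" if "0 < t" "t < 1" for t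
    by (rule ecdf_tendsto[OF assms(1) that])
  show "real (m n \<omega>) / real n \<le> 1" for n
    using lsu_m_le[of \<alpha> n "p n \<omega>"] by (cases "n = 0") (auto simp: divide_le_eq_1)
  show "real (m n \<omega>) / real n \<le> real (count_le n (p n \<omega>) (\<alpha> * (real (m n \<omega>) / real n))) / real n" for n
    using lsu_m_le_count[of \<alpha> n "p n \<omega>"] by (intro divide_right_mono) (auto simp: mult.commute)
  show "\<sigma> \<le> real (m n \<omega>) / real n"
    if "0 < n" "0 < \<sigma>" "\<sigma> \<le> real (count_le n (p n \<omega>) (\<alpha> * \<sigma>)) / real n" for n \<sigma>
    by (rule lsu_m_ge_real[OF that(1) \<alpha>(1) that(2,3)])
qed simp

lemma AE_lsu_m_tendsto:
  "AE \<omega> in M. X 0 \<omega> \<noteq> xs \<and> (\<lambda>n. real (m n \<omega>) / real n) \<longlonglongrightarrow> tcross \<rho> \<alpha> (X 0 \<omega>) / \<alpha>"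
  using AE_conjI[OF empirical_tail_tendsto AE_X_neq[of 0 xs]]
  by eventually_elim (use lsu_m_tendsto in blast)

lemma m_measurable [measurable]: "m n \<in> measurable M (count_space UNIV)"
  by (rule borel_measurable_lsu_m) (simp add: pval_def)

lemma Rn_eq: "Rn \<alpha> \<rho> X (Tr n) n \<omega> = m n \<omega>"
  using \<alpha> by (simp add: Rn_def card_lsu_rejected)

lemma Vn_eq: "real (Vn \<alpha> \<rho> X (Tr n) n \<omega>) = real (m n \<omega>) - (real n - real (card (Tr n)))"
  unfolding Vn_def using \<alpha> Tr by (intro card_lsu_rejected_true) (auto simp: pval_def)

lemma Vn_le: "real (Vn \<alpha> \<rho> X (Tr n) n \<omega>) \<le> real (m n \<omega>)" "real (m n \<omega>) \<le> real n"
  using Vn_eq[of n \<omega>] card_Tr_le[of n] lsu_m_le[of \<alpha> n "p n \<omega>"] by auto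

lemma Vn_measurable [measurable]: "(\<lambda>\<omega>. real (Vn \<alpha> \<rho> X (Tr n) n \<omega>)) \<in> borel_measurable M"
  unfolding Vn_eq by measurable

lemma Vn_tendsto:
  assumes "(\<lambda>n. real (m n \<omega>) / real n) \<longlonglongrightarrow> l"
  shows "(\<lambda>n. real (Vn \<alpha> \<rho> X (Tr n) n \<omega>) / real n) \<longlonglongrightarrow> l"
proof -
  have "(\<lambda>n. real (m n \<omega>) / real n - (1 - real (card (Tr n)) / real n)) \<longlonglongrightarrow> l - (1 - 1)"
    by (intro tendsto_intros assms Tr_lim)
  moreover have "eventually (\<lambda>n. real (m n \<omega>) / real n - (1 - real (card (Tr n)) / real n)
      = real (Vn \<alpha> \<rho> X (Tr n) n \<omega>) / real n) sequentially"
    using eventually_gt_at_top[of 0] unfolding Vn_eq by eventually_elim (simp add: diff_divide_distrib)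
  ultimately show ?thesis using Lim_transform_eventually by fastforce
qed

lemma EER_tendsto:
  "(\<lambda>n. expectation (\<lambda>\<omega>. real (Vn \<alpha> \<rho> X (Tr n) n \<omega>) / real n))
    \<longlonglongrightarrow> expectation (\<lambda>\<omega>. tcross \<rho> \<alpha> (X 0 \<omega>) / \<alpha>)"
proof (rule integral_dominated_convergence[where w = "\<lambda>_. 1"])
  show "AE \<omega> in M. (\<lambda>n. real (Vn \<alpha> \<rho> X (Tr n) n \<omega>) / real n) \<longlonglongrightarrow> tcross \<rho> \<alpha> (X 0 \<omega>) / \<alpha>"
    using AE_lsu_m_tendsto by eventually_elim (use Vn_tendsto in blast)
  show "AE \<omega> in M. norm (real (Vn \<alpha> \<rho> X (Tr n) n \<omega>) / real n) \<le> 1" for n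
    using order_trans[OF Vn_le] by (intro AE_I2) (cases "n = 0"; simp add: divide_le_eq_1)
qed auto

end

section \<open>Limiting error rates\<close>

text \<open>A value in \<open>[0,1]\<close> is the length of the set of \<open>s\<close> below it;
  Tonelli's theorem exchanges the two integrals.\<close>

lemma (in prob_space) expectation_layer_cake:
  assumes [measurable]: "Y \<in> borel_measurable M"
    and Y: "\<And>\<omega>. 0 \<le> Y \<omega>" "\<And>\<omega>. Y \<omega> \<le> 1"
  shows prob_gt_measurable: "(\<lambda>s. prob {\<omega> \<in> space M. s < Y \<omega>}) \<in> borel_measurable lborel"
    and expectation_eq_integral_prob_gt:
      "expectation Y = (LBINT s:{0..<1}. prob {\<omega> \<in> space M. s < Y \<omega>})"
proof -
  interpret pair_sigma_finite M "lborel :: real measure" ..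
  have ind: "(\<integral>\<^sup>+ \<omega>. indicator {s<..} (Y \<omega>) \<partial>M) = emeasure M {\<omega> \<in> space M. s < Y \<omega>}" for s
  proof -
    have "(\<integral>\<^sup>+ \<omega>. indicator {s<..} (Y \<omega>) \<partial>M) = (\<integral>\<^sup>+ \<omega>. indicator {\<omega> \<in> space M. s < Y \<omega>} \<omega> \<partial>M)"
      by (intro nn_integral_cong) (auto simp: indicator_def)
    then show ?thesis by simp
  qed
  have "(\<lambda>s. enn2real (\<integral>\<^sup>+ \<omega>. indicator {s<..} (Y \<omega>) \<partial>M)) \<in> borel_measurable lborel"
    unfolding indicator_def greaterThan_iff by measurable
  then show m [measurable]: "(\<lambda>s. prob {\<omega> \<in> space M. s < Y \<omega>}) \<in> borel_measurable lborel"
    unfolding ind by (simp add: measure_def)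
  have "(\<integral>\<^sup>+ \<omega>. ennreal (Y \<omega>) \<partial>M) = (\<integral>\<^sup>+ \<omega>. \<integral>\<^sup>+ s. indicator {0..<1} s * (if s < Y \<omega> then 1 else 0) \<partial>lborel \<partial>M)"
  proof (rule nn_integral_cong)
    fix \<omega>
    have "(\<integral>\<^sup>+ s. indicator {0..<1} s * (if s < Y \<omega> then 1 else 0) \<partial>lborel) = (\<integral>\<^sup>+ s. indicator {0..<Y \<omega>} s \<partial>lborel)"
      using Y[of \<omega>] by (intro nn_integral_cong) (auto simp: indicator_def)
    then show "ennreal (Y \<omega>) = (\<integral>\<^sup>+ s. indicator {0..<1} s * (if s < Y \<omega> then 1 else 0) \<partial>lborel)"
      using Y[of \<omega>] by simp
  qed
  also have "\<dots> = (\<integral>\<^sup>+ s. \<integral>\<^sup>+ \<omega>. indicator {0..<1} s * (if s < Y \<omega> then 1 else 0) \<partial>M \<partial>lborel)"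
    by (rule Fubini'[symmetric]) measurable
  also have "\<dots> = (\<integral>\<^sup>+ s. ennreal (indicator {0..<1} s *\<^sub>R prob {\<omega> \<in> space M. s < Y \<omega>}) \<partial>lborel)"
  proof (rule nn_integral_cong)
    fix s :: real
    have "(\<integral>\<^sup>+ \<omega>. indicator {0..<1} s * (if s < Y \<omega> then 1 else 0) \<partial>M)
        = (\<integral>\<^sup>+ \<omega>. indicator {0..<1} s * indicator {s<..} (Y \<omega>) \<partial>M)"
      by (intro nn_integral_cong) (auto simp: indicator_def)
    also have "\<dots> = indicator {0..<1} s * emeasure M {\<omega> \<in> space M. s < Y \<omega>}"
      by (subst nn_integral_cmult) (auto simp: ind)
    finally show "(\<integral>\<^sup>+ \<omega>. indicator {0..<1} s * (if s < Y \<omega> then 1 else 0) \<partial>M)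
        = ennreal (indicator {0..<1} s *\<^sub>R prob {\<omega> \<in> space M. s < Y \<omega>})"
      by (auto simp: indicator_def emeasure_eq_measure)
  qed
  finally have eq: "(\<integral>\<^sup>+ \<omega>. ennreal (Y \<omega>) \<partial>M) = (\<integral>\<^sup>+ s. ennreal (indicator {0..<1} s *\<^sub>R prob {\<omega> \<in> space M. s < Y \<omega>}) \<partial>lborel)" .
  have "expectation Y = enn2real (\<integral>\<^sup>+ \<omega>. ennreal (Y \<omega>) \<partial>M)"
    by (rule integral_eq_nn_integral) (auto simp: Y)
  also have "\<dots> = (LBINT s:{0..<1}. prob {\<omega> \<in> space M. s < Y \<omega>})"
    unfolding eq set_lebesgue_integral_def by (rule integral_eq_nn_integral[symmetric]) auto
  finally show "expectation Y = (LBINT s:{0..<1}. prob {\<omega> \<in> space M. s < Y \<omega>})" .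
qed

section \<open>Evaluation of the two limits\<close>

context dex_model begin

lemma prob_X0_less: "prob {\<omega> \<in> space M. X 0 \<omega> < y} = Phi y"
  using prob_X[of "{..<y}" 0] by (simp add: measure_std_normal)

lemma expectation_tcross:
  "expectation (\<lambda>\<omega>. tcross \<rho> \<alpha> (X 0 \<omega>) / \<alpha>)
    = tt * Phi xs / \<alpha> + (LBINT t=tt / \<alpha>..1. Phi (x0_of \<rho> \<alpha> (\<alpha> * t)))"
proof -
  define Y where "Y \<omega> = tcross \<rho> \<alpha> (X 0 \<omega>) / \<alpha>" for \<omega>
  define g where "g s = prob {\<omega> \<in> space M. s < Y \<omega>}" for s
  define \<tau> where "\<tau> = tt / \<alpha>"
  have \<tau>: "0 < \<tau>" "\<tau> < 1" using t2_bounds \<alpha> by (auto simp: \<tau>_def)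
  have [measurable]: "Y \<in> borel_measurable M" unfolding Y_def by measurable
  have Y01: "0 \<le> Y \<omega>" "Y \<omega> \<le> 1" for \<omega>
    using tcross_bounds[of "X 0 \<omega>"] \<alpha> by (auto simp: Y_def)
  have gm [measurable]: "g \<in> borel_measurable lborel"
    unfolding g_def[abs_def] by (rule prob_gt_measurable) (auto simp: Y01)
  \<comment> \<open>Almost surely the crossing point is 0 or exceeds \<open>tt\<close>, so all tail
    events below \<open>\<tau>\<close> coincide. This produces the first term of the
    formula.\<close>
  have g_lo: "g s = Phi xs" if "0 \<le> s" "s < \<tau>" for s
  proof -
    have "AE \<omega> in M. \<omega> \<in> {\<omega> \<in> space M. s < Y \<omega>} \<longleftrightarrow> \<omega> \<in> {\<omega> \<in> space M. X 0 \<omega> < xs}"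
      using AE_X_neq[of 0 xs]
    proof eventually_elim
      case (elim \<omega>)
      have "s * \<alpha> < tt" using that \<alpha> by (simp add: \<tau>_def pos_less_divide_eq)
      then have "s < Y \<omega> \<longleftrightarrow> X 0 \<omega> < xs"
        using tcross_below(1)[of "X 0 \<omega>"] tcross_above[of "X 0 \<omega>"] elim that \<alpha>
        by (cases "X 0 \<omega>" xs rule: linorder_cases) (auto simp: Y_def pos_less_divide_eq)
      then show ?case by simp
    qed
    then have "g s = prob {\<omega> \<in> space M. X 0 \<omega> < xs}"
      unfolding g_def by (intro finite_measure_eq_AE) auto
    then show ?thesis by (simp add: prob_X0_less)
  qed
  have g_hi: "g s = Phi (x0_of \<rho> \<alpha> (\<alpha> * s))" if "\<tau> \<le> s" "s < 1" for s
  proof -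
    have s: "tt \<le> \<alpha> * s" "\<alpha> * s < \<alpha>" using that \<alpha> by (auto simp: \<tau>_def pos_divide_le_eq mult.commute)
    have "AE \<omega> in M. \<omega> \<in> {\<omega> \<in> space M. s < Y \<omega>} \<longleftrightarrow> \<omega> \<in> {\<omega> \<in> space M. X 0 \<omega> < x0_of \<rho> \<alpha> (\<alpha> * s)}"
      using AE_X_neq[of 0 xs]
    proof eventually_elim
      case (elim \<omega>)
      have "s < Y \<omega> \<longleftrightarrow> \<alpha> * s < tcross \<rho> \<alpha> (X 0 \<omega>)"
        using \<alpha> by (simp add: Y_def pos_less_divide_eq mult.commute)
      then show ?case using less_tcross_iff[OF elim s] by simp
    qed
    then have "g s = prob {\<omega> \<in> space M. X 0 \<omega> < x0_of \<rho> \<alpha> (\<alpha> * s)}"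
      unfolding g_def by (intro finite_measure_eq_AE) auto
    then show ?thesis by (simp add: prob_X0_less)
  qed
  have g_int: "set_integrable lborel {a..<b} g" if "a \<le> b" for a b
    unfolding set_integrable_def
    by (rule integrableI_bounded_set_indicator[where B = 1])
      (use that gm in \<open>auto simp: g_def\<close>)
  have "expectation Y = (LBINT s:{0..<1}. g s)"
    unfolding g_def by (rule expectation_eq_integral_prob_gt) (auto simp: Y01)
  also have "{0..<1} = {0..<\<tau>} \<union> {\<tau>..<1}" using \<tau> by auto
  also have "(LBINT s:{0..<\<tau>} \<union> {\<tau>..<1}. g s) = (LBINT s:{0..<\<tau>}. g s) + (LBINT s:{\<tau>..<1}. g s)"
    by (rule set_integral_Un) (use \<tau> in \<open>auto simp: g_int\<close>)
  also have "(LBINT s:{0..<\<tau>}. g s) = (LBINT s:{0..<\<tau>}. Phi xs)"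
    by (rule set_lebesgue_integral_cong) (auto simp: g_lo)
  also have "\<dots> = \<tau> * Phi xs"
    using \<tau> by (simp add: set_lebesgue_integral_def)
  also have "(LBINT s:{\<tau>..<1}. g s) = (LBINT s:{\<tau>..<1}. Phi (x0_of \<rho> \<alpha> (\<alpha> * s)))"
    by (rule set_lebesgue_integral_cong) (auto simp: g_hi)
  also have "\<dots> = (LBINT s=\<tau>..1. Phi (x0_of \<rho> \<alpha> (\<alpha> * s)))"
    using interval_integral_Ico[of \<tau> 1 "\<lambda>s. Phi (x0_of \<rho> \<alpha> (\<alpha> * s))"] \<tau> by (simp add: one_ereal_def)
  finally show ?thesis by (simp add: Y_def[abs_def] \<tau>_def)
qed

abbreviation W :: "nat \<Rightarrow> 'a \<Rightarrow> real" where
  "W n \<omega> \<equiv> real (Vn \<alpha> \<rho> X (Tr n) n \<omega>) / max 1 (real (m n \<omega>))"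

lemma W_bounds: "0 \<le> W n \<omega>" "W n \<omega> \<le> 1"
  using Vn_le(1)[of n \<omega>] by (auto simp: divide_le_eq_1 less_max_iff_disj)

text \<open>Numerator and denominator, divided by \<open>n\<close>, have the same positive
  limit.\<close>

lemma W_tendsto_1:
  assumes "(\<lambda>n. real (m n \<omega>) / real n) \<longlonglongrightarrow> l" "0 < l"
  shows "(\<lambda>n. W n \<omega>) \<longlonglongrightarrow> 1"
proof -
  have "(\<lambda>n. (real (Vn \<alpha> \<rho> X (Tr n) n \<omega>) / real n) / (real (m n \<omega>) / real n)) \<longlonglongrightarrow> l / l"
    using assms by (intro tendsto_divide Vn_tendsto) auto
  moreover have "eventually (\<lambda>n. (real (Vn \<alpha> \<rho> X (Tr n) n \<omega>) / real n) / (real (m n \<omega>) / real n) = W n \<omega>) sequentially"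
    using order_tendstoD(1)[OF assms] eventually_gt_at_top[of 0]
  proof eventually_elim
    case (elim n)
    then have "0 < m n \<omega>" by (cases "m n \<omega> = 0") auto
    then have "max 1 (real (m n \<omega>)) = real (m n \<omega>)" by simp
    then show ?case using elim by simp
  qed
  ultimately show ?thesis using Lim_transform_eventually assms(2) by fastforce
qed

lemma W_below_tendsto:
  "(\<lambda>n. expectation (\<lambda>\<omega>. if X 0 \<omega> < xs then W n \<omega> else 0)) \<longlonglongrightarrow> Phi xs"
proof -
  have "(\<lambda>n. expectation (\<lambda>\<omega>. if X 0 \<omega> < xs then W n \<omega> else 0))
      \<longlonglongrightarrow> expectation (indicator {\<omega> \<in> space M. X 0 \<omega> < xs})"
  proof (rule integral_dominated_convergence[where w = "\<lambda>_. 1"])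
    show "AE \<omega> in M. (\<lambda>n. if X 0 \<omega> < xs then W n \<omega> else 0) \<longlonglongrightarrow> indicator {\<omega> \<in> space M. X 0 \<omega> < xs} \<omega>"
      using AE_lsu_m_tendsto AE_space
    proof eventually_elim
      case (elim \<omega>)
      show ?case
      proof (cases "X 0 \<omega> < xs")
        case True
        have "0 < tcross \<rho> \<alpha> (X 0 \<omega>) / \<alpha>"
          using tcross_below(1)[OF True] t2_bounds \<alpha> by simp
        then show ?thesis using W_tendsto_1 elim True by simp
      qed (simp add: indicator_def)
    qed
    show "AE \<omega> in M. norm (if X 0 \<omega> < xs then W n \<omega> else 0) \<le> 1" for n
      using W_bounds[of n] by (intro AE_I2) auto
  qed auto
  then show ?thesis by (simp add: prob_X0_less)
qed

text \<open>A bound for the truncated reciprocal p-value when \<open>X 0\<close> exceeds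
  \<open>xs\<close>: with \<open>xs\<close> in place of \<open>X 0\<close> it depends on a single
  \<open>X i\<close> only, so its expectation is the same for all \<open>i\<close>.\<close>

definition z :: "real \<Rightarrow> real \<Rightarrow> real" where
  "z \<delta> x = (if 1 - Phi (c * x - r * xs) \<le> \<delta> then 1 / (1 - Phi (c * x - r * xs)) else 0)"

lemma z_nonneg: "0 \<le> z \<delta> x"
  by (simp add: z_def less_imp_le)

lemma z_measurable [measurable]: "z \<delta> \<in> borel_measurable borel"
  unfolding z_def by measurable

text \<open>Since \<open>c < 1\<close>, the standard normal density outweighs the reciprocal of the tail
  at \<open>c * x - r * xs\<close>.\<close>
lemma density_tail_integrable:
  "integrable lborel (\<lambda>x. std_normal_density x / (1 - Phi (c * x - r * xs)))"
proof -
  \<comment> \<open>The constants come from bounding \<open>v\<close> by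
    \<open>c * \<bar>x\<bar> + k\<close> and completing the square: half of the gain
    \<open>r\<^sup>2 * x\<^sup>2\<close> absorbs the mixed term, the rest is the exponent of a
    normal density with deviation \<open>s\<close>.\<close>
  define k where "k = r * \<bar>xs\<bar> + 1"
  define C where "C = c\<^sup>2 * k\<^sup>2 / r\<^sup>2 + k\<^sup>2 / 2"
  define s where "s = sqrt 2 / r"
  have s: "0 < s" "s\<^sup>2 = 2 / r\<^sup>2" using rc by (auto simp: s_def power_divide)
  have le: "std_normal_density x / (1 - Phi (c * x - r * xs))
      \<le> exp C * sqrt (2 * pi * s\<^sup>2) * normal_density 0 s x" for x
  proof -
    define v where "v = \<bar>c * x - r * xs\<bar> + 1"
    have "v \<le> c * \<bar>x\<bar> + k"
      using abs_triangle_ineq4[of "c * x" "r * xs"] rc by (simp add: v_def k_def abs_mult)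
    then have "v\<^sup>2 \<le> (c * \<bar>x\<bar> + k)\<^sup>2" by (rule power_mono) (simp add: v_def)
    moreover have "0 \<le> (r * \<bar>x\<bar> - 2 * c * k / r)\<^sup>2" by simp
    then have "2 * (2 * c * k * \<bar>x\<bar>) \<le> r\<^sup>2 * x\<^sup>2 + 4 * (c\<^sup>2 * k\<^sup>2 / r\<^sup>2)"
      using rc by (simp add: power2_diff power_mult_distrib power_divide mult_ac)
    moreover have "(c * \<bar>x\<bar> + k)\<^sup>2 = c\<^sup>2 * x\<^sup>2 + 2 * c * k * \<bar>x\<bar> + k\<^sup>2"
      by (simp add: power2_sum power_mult_distrib)
    moreover have "c\<^sup>2 * x\<^sup>2 = x\<^sup>2 - r\<^sup>2 * x\<^sup>2"
    proof -
      have "c\<^sup>2 = 1 - r\<^sup>2" using rc(5) by linarith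
      then show ?thesis by (simp add: left_diff_distrib)
    qed
    ultimately have ex: "v\<^sup>2 / 2 - x\<^sup>2 / 2 \<le> C - r\<^sup>2 * x\<^sup>2 / 4"
      unfolding C_def by linarith
    have "std_normal_density x / (1 - Phi (c * x - r * xs)) \<le> std_normal_density x / std_normal_density v"
      using Phi_tail_ge[of "c * x - r * xs"] normal_density_pos[of 1 0 v] unfolding v_def
      by (intro divide_left_mono mult_pos_pos) (auto intro: less_le_trans)
    also have "\<dots> = exp (- x\<^sup>2 / 2) / exp (- v\<^sup>2 / 2)"
      by (simp add: std_normal_density_def)
    also have "\<dots> = exp (v\<^sup>2 / 2 - x\<^sup>2 / 2)"
      by (simp only: exp_diff[symmetric]) simp
    also have "\<dots> \<le> exp (C - r\<^sup>2 * x\<^sup>2 / 4)" using ex by simp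
    also have "\<dots> = exp C * exp (- (x - 0)\<^sup>2 / (2 * s\<^sup>2))"
      using rc by (simp add: s exp_add[symmetric])
    also have "\<dots> = exp C * sqrt (2 * pi * s\<^sup>2) * normal_density 0 s x"
      using s(1) by (simp add: normal_density_def)
    finally show ?thesis .
  qed
  show ?thesis
  proof (rule Bochner_Integration.integrable_bound)
    show "integrable lborel (\<lambda>x. exp C * sqrt (2 * pi * s\<^sup>2) * normal_density 0 s x)"
      by (intro integrable_mult_right integrable_normal_density s(1))
    show "AE x in lborel. norm (std_normal_density x / (1 - Phi (c * x - r * xs)))
        \<le> norm (exp C * sqrt (2 * pi * s\<^sup>2) * normal_density 0 s x)"
    proof (rule AE_I2)
      fix x
      have "0 \<le> std_normal_density x / (1 - Phi (c * x - r * xs))"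
        using Phi_bounds(2)[of "c * x - r * xs"] by (simp add: less_imp_le)
      then show "norm (std_normal_density x / (1 - Phi (c * x - r * xs)))
          \<le> norm (exp C * sqrt (2 * pi * s\<^sup>2) * normal_density 0 s x)"
        using le[of x] unfolding real_norm_def by linarith
    qed
  qed measurable
qed

lemma density_z_bound: "norm (std_normal_density x * z \<delta> x) \<le> std_normal_density x / (1 - Phi (c * x - r * xs))"
proof -
  define q where "q = 1 - Phi (c * x - r * xs)"
  have "0 < q" by (simp add: q_def)
  then show ?thesis unfolding z_def q_def[symmetric] by simp
qed

lemma density_z_integrable: "integrable lborel (\<lambda>x. std_normal_density x * z \<delta> x)"
proof (rule Bochner_Integration.integrable_bound[OF density_tail_integrable])
  show "AE x in lborel. norm (std_normal_density x * z \<delta> x)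
      \<le> norm (std_normal_density x / (1 - Phi (c * x - r * xs)))"
    by (rule AE_I2, rule order_trans[OF density_z_bound]) (simp only: real_norm_def abs_ge_self)
qed measurable

lemma z_X_integrable: "integrable M (\<lambda>\<omega>. z \<delta> (X i \<omega>))"
  using distributed_integrable[OF distr, of "z \<delta>" i] density_z_integrable by simp

lemma expectation_z_X: "expectation (\<lambda>\<omega>. z \<delta> (X i \<omega>)) = (\<integral>x. std_normal_density x * z \<delta> x \<partial>lborel)"
  using distributed_integral[OF distr, of "z \<delta>" i] by simp

text \<open>Each tail value is positive, so the truncation eventually removes it; the integrable
  majorant does not depend on the truncation.\<close>

lemma integral_z_tendsto_0:
  "(\<lambda>k. \<integral>x. std_normal_density x * z (1 / real (Suc k)) x \<partial>lborel) \<longlonglongrightarrow> 0"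
proof -
  have "(\<lambda>k. \<integral>x. std_normal_density x * z (1 / real (Suc k)) x \<partial>lborel) \<longlonglongrightarrow> (\<integral>x. 0 \<partial>(lborel :: real measure))"
  proof (rule integral_dominated_convergence[OF _ _ density_tail_integrable])
    show "AE x in lborel. (\<lambda>k. std_normal_density x * z (1 / real (Suc k)) x) \<longlonglongrightarrow> 0"
    proof (rule AE_I2)
      fix x
      have "0 < 1 - Phi (c * x - r * xs)" by simp
      then have "eventually (\<lambda>k. 1 / real (Suc k) < 1 - Phi (c * x - r * xs)) sequentially"
        using order_tendstoD(2)[OF LIMSEQ_inverse_real_of_nat] by (simp add: inverse_eq_divide)
      then have "eventually (\<lambda>k. std_normal_density x * z (1 / real (Suc k)) x = 0) sequentially"
        by eventually_elim (simp add: z_def)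
      then show "(\<lambda>k. std_normal_density x * z (1 / real (Suc k)) x) \<longlonglongrightarrow> 0"
        by (rule tendsto_eventually)
    qed
    show "AE x in lborel. norm (std_normal_density x * z (1 / real (Suc k)) x)
        \<le> std_normal_density x / (1 - Phi (c * x - r * xs))" for k
      by (rule AE_I2) (rule density_z_bound)
  qed auto
  then show ?thesis by simp
qed

text \<open>If the rejection threshold exceeds \<open>\<delta>\<close>, the trivial bound 1 is used;
  otherwise every rejected p-value is at most \<open>\<delta>\<close> and the reciprocal bound
  applies.\<close>

lemma W_above_le:
  assumes "0 < n" "xs < X 0 \<omega>"
  shows "W n \<omega> \<le> (if \<delta> < \<alpha> * (real (m n \<omega>) / real n) then 1 else 0)
    + \<alpha> / real n * (\<Sum>i\<in>Tr n. z \<delta> (X i \<omega>))"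
proof (cases "\<delta> < \<alpha> * (real (m n \<omega>) / real n)")
  case True
  have "0 \<le> \<alpha> / real n * (\<Sum>i\<in>Tr n. z \<delta> (X i \<omega>))"
    using \<alpha> by (intro mult_nonneg_nonneg sum_nonneg z_nonneg) simp
  then show ?thesis unfolding if_P[OF True] using W_bounds(2)[of n \<omega>] by linarith
next
  case False
  have pv: "p n \<omega> i = 1 - Phi (c * X i \<omega> - r * X 0 \<omega>)" if "i \<in> Tr n" for i
    using that by (simp add: pval_def c_def r_def)
  have "W n \<omega> \<le> \<alpha> / real n * (\<Sum>i\<in>Tr n. if p n \<omega> i \<le> \<delta> then 1 / p n \<omega> i else 0)"
    unfolding Vn_def using False assms(1) \<alpha> Tr
    by (intro false_discovery_proportion_le) (auto simp: pv)
  also have "\<dots> \<le> \<alpha> / real n * (\<Sum>i\<in>Tr n. z \<delta> (X i \<omega>))"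
  proof (intro mult_left_mono sum_mono)
    fix i assume i: "i \<in> Tr n"
    define q where "q = 1 - Phi (c * X i \<omega> - r * xs)"
    have "r * xs \<le> r * X 0 \<omega>" using assms(2) rc by simp
    \<comment> \<open>Lowering \<open>X 0\<close> to \<open>xs\<close> lowers the p-value, which can
      only enlarge both the truncation indicator and the reciprocal.\<close>
    then have "q \<le> p n \<omega> i" unfolding pv[OF i] q_def by simp
    moreover have "0 < q" by (simp add: q_def)
    moreover from calculation have "1 / p n \<omega> i \<le> 1 / q" by (intro divide_left_mono) auto
    ultimately show "(if p n \<omega> i \<le> \<delta> then 1 / p n \<omega> i else 0) \<le> z \<delta> (X i \<omega>)"
      unfolding z_def q_def[symmetric] by auto
  qed (use \<alpha> in simp)
  finally show ?thesis using False by simp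
qed

text \<open>First \<open>\<delta>\<close> is fixed so that the reciprocal term is below
  \<open>e / 2\<close> for all positive \<open>n\<close>; then \<open>n\<close> is taken large,
  since above \<open>xs\<close> the rejection proportion tends to 0.\<close>

lemma W_above_tendsto:
  "(\<lambda>n. expectation (\<lambda>\<omega>. if xs < X 0 \<omega> then W n \<omega> else 0)) \<longlonglongrightarrow> 0"
proof (rule tendstoI)
  fix e :: real assume "0 < e"
  let ?E = "\<lambda>n. expectation (\<lambda>\<omega>. if xs < X 0 \<omega> then W n \<omega> else 0)"
  have "eventually (\<lambda>k. (\<integral>x. std_normal_density x * z (1 / real (Suc k)) x \<partial>lborel) < e / 2) sequentially"
    using order_tendstoD(2)[OF integral_z_tendsto_0, of "e / 2"] \<open>0 < e\<close> by simp
  then obtain k where k: "(\<integral>x. std_normal_density x * z (1 / real (Suc k)) x \<partial>lborel) < e / 2"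
    by (auto simp: eventually_sequentially)
  define \<delta> where "\<delta> = 1 / real (Suc k)"
  have \<delta>: "0 < \<delta>" by (simp add: \<delta>_def)
  let ?I = "\<lambda>n \<omega>. if xs < X 0 \<omega> \<and> \<delta> < \<alpha> * (real (m n \<omega>) / real n) then 1 else 0 :: real"
  have "(\<lambda>n. expectation (?I n)) \<longlonglongrightarrow> expectation (\<lambda>_. 0)"
  proof (rule integral_dominated_convergence[where w = "\<lambda>_. 1"])
    show "AE \<omega> in M. (\<lambda>n. ?I n \<omega>) \<longlonglongrightarrow> 0"
      using AE_lsu_m_tendsto
    proof eventually_elim
      case (elim \<omega>)
      show ?case
      proof (cases "xs < X 0 \<omega>")
        case True
        then have "(\<lambda>n. \<alpha> * (real (m n \<omega>) / real n)) \<longlonglongrightarrow> \<alpha> * 0"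
          using elim tcross_above[OF True] by (intro tendsto_mult_left) simp
        then have "eventually (\<lambda>n. \<alpha> * (real (m n \<omega>) / real n) < \<delta>) sequentially"
          using \<delta> by (intro order_tendstoD) auto
        then have "eventually (\<lambda>n. ?I n \<omega> = 0) sequentially" by eventually_elim auto
        then show ?thesis by (rule tendsto_eventually)
      qed simp
    qed
  qed auto
  then have "eventually (\<lambda>n. expectation (?I n) < e / 2) sequentially"
    using \<open>0 < e\<close> by (intro order_tendstoD(2)) auto
  then show "eventually (\<lambda>n. dist (?E n) 0 < e) sequentially"
    using eventually_gt_at_top[of 0]
  proof eventually_elim
    case (elim n)
    have intI: "integrable M (?I n)"
      by (rule integrable_const_bound[where B = 1]) auto
    have intW: "integrable M (\<lambda>\<omega>. if xs < X 0 \<omega> then W n \<omega> else 0)"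
      by (rule integrable_const_bound[where B = 1]) (use W_bounds[of n] in auto)
    have intz: "integrable M (\<lambda>\<omega>. \<alpha> / real n * (\<Sum>i\<in>Tr n. z \<delta> (X i \<omega>)))"
      by (intro integrable_mult_right Bochner_Integration.integrable_sum z_X_integrable)
    have "?E n \<le> expectation (\<lambda>\<omega>. ?I n \<omega> + \<alpha> / real n * (\<Sum>i\<in>Tr n. z \<delta> (X i \<omega>)))"
    proof (rule integral_mono[OF intW Bochner_Integration.integrable_add[OF intI intz]])
      fix \<omega>
      have "0 \<le> \<alpha> / real n * (\<Sum>i\<in>Tr n. z \<delta> (X i \<omega>))"
        using \<alpha> by (intro mult_nonneg_nonneg sum_nonneg z_nonneg) auto
      then show "(if xs < X 0 \<omega> then W n \<omega> else 0) \<le> ?I n \<omega> + \<alpha> / real n * (\<Sum>i\<in>Tr n. z \<delta> (X i \<omega>))"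
        using W_above_le[OF elim(2), of \<omega> \<delta>] by auto
    qed
    also have "\<dots> = expectation (?I n) + expectation (\<lambda>\<omega>. \<alpha> / real n * (\<Sum>i\<in>Tr n. z \<delta> (X i \<omega>)))"
      by (rule Bochner_Integration.integral_add[OF intI intz])
    also have "expectation (\<lambda>\<omega>. \<alpha> / real n * (\<Sum>i\<in>Tr n. z \<delta> (X i \<omega>)))
        = \<alpha> / real n * (real (card (Tr n)) * (\<integral>x. std_normal_density x * z \<delta> x \<partial>lborel))"
      by (simp add: Bochner_Integration.integral_sum z_X_integrable expectation_z_X)
    also have "\<dots> \<le> 1 * (\<integral>x. std_normal_density x * z \<delta> x \<partial>lborel)"
    proof -
      have "\<alpha> / real n * real (card (Tr n)) \<le> 1"
        using mult_mono[of \<alpha> 1 "real (card (Tr n))" "real n"] \<alpha> card_Tr_le[of n] elim(2)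
        by (simp add: pos_divide_le_eq)
      moreover have "0 \<le> (\<integral>x. std_normal_density x * z \<delta> x \<partial>lborel)"
        by (intro Bochner_Integration.integral_nonneg mult_nonneg_nonneg z_nonneg) simp
      ultimately show ?thesis by (metis mult.assoc mult_right_mono)
    qed
    finally have "?E n < e" using elim(1) k unfolding \<delta>_def by linarith
    moreover have "0 \<le> ?E n" using W_bounds(1) by (intro Bochner_Integration.integral_nonneg) auto
    ultimately show ?case by simp
  qed
qed

text \<open>The expectation splits at the tangent level, which \<open>X 0\<close> hits with
  probability 0; only the part below it survives in the limit.\<close>

lemma FDR_tendsto: "(\<lambda>n. expectation (W n)) \<longlonglongrightarrow> Phi xs"
proof -
  have "expectation (W n) = expectation (\<lambda>\<omega>. if X 0 \<omega> < xs then W n \<omega> else 0)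
      + expectation (\<lambda>\<omega>. if xs < X 0 \<omega> then W n \<omega> else 0)" for n
  proof -
    have int: "integrable M (\<lambda>\<omega>. if X 0 \<omega> < xs then W n \<omega> else 0)"
      "integrable M (\<lambda>\<omega>. if xs < X 0 \<omega> then W n \<omega> else 0)"
      by (rule integrable_const_bound[where B = 1]; use W_bounds[of n] in auto)+
    have "expectation (W n) = expectation (\<lambda>\<omega>. (if X 0 \<omega> < xs then W n \<omega> else 0)
        + (if xs < X 0 \<omega> then W n \<omega> else 0))"
    proof (rule integral_cong_AE)
      show "AE \<omega> in M. W n \<omega> = (if X 0 \<omega> < xs then W n \<omega> else 0) + (if xs < X 0 \<omega> then W n \<omega> else 0)"
        using AE_X_neq[of 0 xs] by eventually_elim auto
    qed auto
    then show ?thesis by (simp only: Bochner_Integration.integral_add[OF int])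
  qed
  then show ?thesis using tendsto_add[OF W_below_tendsto W_above_tendsto] by simp
qed

end

theorem theorem3p2:
  fixes M :: "'a measure" and X :: "nat \<Rightarrow> 'a \<Rightarrow> real"
    and \<alpha> \<rho> :: real and n0 :: "nat \<Rightarrow> nat" and Tr :: "nat \<Rightarrow> nat set"
  assumes "prob_space M"
    and "prob_space.indep_vars M (\<lambda>_. borel) X UNIV"
    and "\<And>i. distributed M lborel (X i) (\<lambda>x. ennreal (std_normal_density x))"
    and "0 < \<alpha>" "\<alpha> < 1" "0 < \<rho>" "\<rho> < 1"
    and "\<And>n. Tr n \<subseteq> {1..n}" "\<And>n. card (Tr n) = n0 n"
    and "(\<lambda>n. real (n0 n) / real n) \<longlonglongrightarrow> 1"
  shows "C1 \<rho> \<alpha> = {0} \<union> {t2 \<rho> \<alpha><..<\<alpha>}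
    \<and> (\<lambda>n. integral\<^sup>L M (\<lambda>\<omega>. real (Vn \<alpha> \<rho> X (Tr n) n \<omega>) / real n))
        \<longlonglongrightarrow> t2 \<rho> \<alpha> * Phi (x0_of \<rho> \<alpha> (t2 \<rho> \<alpha>)) / \<alpha>
            + (LBINT t=t2 \<rho> \<alpha> / \<alpha>..1. Phi (x0_of \<rho> \<alpha> (\<alpha> * t)))
    \<and> (\<lambda>n. integral\<^sup>L M (\<lambda>\<omega>. real (Vn \<alpha> \<rho> X (Tr n) n \<omega>)
                                 / max 1 (real (Rn \<alpha> \<rho> X (Tr n) n \<omega>))))
        \<longlonglongrightarrow> Phi (x0_of \<rho> \<alpha> (t2 \<rho> \<alpha>))"
proof -
  interpret prob_space M by fact
  interpret dex_model M \<alpha> \<rho> X Tr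
    by unfold_locales (use assms in auto)
  show ?thesis
    using C1_eq EER_tendsto FDR_tendsto unfolding expectation_tcross Rn_eq x0_of_t2 by blast
qed

end
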